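(* Let $X$ be a real Banach space with a normalized unconditional basis $(e_i)_{i\in\mathbb{N}}$. If $X$ is an asymptotic $\ell_2$ space for vectors with disjoint supports, then $X$ is a weak Hilbert space.
   Context: $\mathbb{N}=\{1,2,\dots\}$. $c_{00}$ is the space of finitely supported real sequences, with unit vector basis $(e_i)$. A Banach space $X$ with a (normalized) basis is regarded as the completion of $c_{00}$ under a norm $\|\cdot\|$, with $(e_i)$ corresponding to the basis. For $x=(x_j)\in c_{00}$, $\mathrm{supp}(x)=\{j: x_j\neq 0\}$. Schreier family $S_1$: a finite set $F\subset\mathbb{N}$ belongs to $S_1$ iff $F=\emptyset$ or $|F|\le \min F$. A finite family $(E_i)$ of finite non-empty subsets of $\mathbb{N}$ is $S_1$-allowable if the $E_i$ are pairwise disjoint and $\{\min E_i\}_i\in S_1$. For $C>0$ and $1\le p<\infty$, vectors $x_1,\dots,x_n$ are $C$-equivalent to the unit vector basis of $\ell_p^n$ if there are $A,B>0$ with $AB\le C$ and $\frac1A(\sum_i|a_i|^p)^{1/p}\le\|\sum_i a_ix_i\|\le B(\sum_i|a_i|^p)^{1/p}$ for all scalars $(a_i)_{i=1}^n$. $X$ is an asymptotic $\ell_p$ space for vectors with disjoint supports (with constant $C$) if there is $C>0$ such that for every $n$ and every sequence $(x_i)_{i=1}^n$ of norm-one vectors of $c_{00}\subset X$ with $(\mathrm{supp}(x_i))_{i=1}^n$ $S_1$-allowable, $(x_i)_{i=1}^n$ is $C$-equivalent to the unit vector basis of $\ell_p^n$. For a finite dimensional Banach space $F$, $d(F)$ is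 the Banach–Mazur distance between $F$ and $\ell_2^{\dim F}$. A Banach space $X$ is a weak Hilbert space if there exist $\delta>0$ and $C\ge1$ such that every finite dimensional subspace $E$ of $X$ contains a subspace $F\subseteq E$ for which there is a (bounded linear) projection $P:X\to F$ onto $F$ with $\dim F\ge\delta\dim E$, $d(F)\le C$ and $\|P\|\le C$. *)

theory Defs
  imports "HOL-Analysis.Analysis"
begin

text \<open>
  Throughout, the index set of bases and coordinates is $\{1, 2, \dots\}$. A family indexed by it
  is a function on \<^typ>\<open>nat\<close> whose value at 0 is irrelevant (for a basis) or required to be 0
  (for a coordinate sequence).
\<close>

section \<open>Bases\<close>

definition schauder_basis :: "(nat \<Rightarrow> 'a::banach) \<Rightarrow> bool" where
  "schauder_basis e \<longleftrightarrow>
     (\<forall>x. \<exists>!a::nat \<Rightarrow> real. a 0 = 0 \<and> (\<lambda>n. a (Suc n) *\<^sub>R e (Suc n)) sums x)"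

text \<open>Unconditional convergence of a basis expansion is convergence of the net of its finite
  partial sums, that is \<^const>\<open>summable_on\<close>.\<close>

definition unconditional_basis :: "(nat \<Rightarrow> 'a::banach) \<Rightarrow> bool" where
  "unconditional_basis e \<longleftrightarrow> schauder_basis e \<and>
     (\<forall>a::nat \<Rightarrow> real. summable (\<lambda>n. a (Suc n) *\<^sub>R e (Suc n)) \<longrightarrow>
        (\<lambda>n. a n *\<^sub>R e n) summable_on {1..})"

definition normalized :: "(nat \<Rightarrow> 'a::real_normed_vector) \<Rightarrow> bool" where
  "normalized e \<longleftrightarrow> (\<forall>n\<ge>1. norm (e n) = 1)"


section \<open>Finitely supported vectors and allowable families\<close>

definition supp :: "(nat \<Rightarrow> real) \<Rightarrow> nat set" where
  "supp x = {j. x j \<noteq> 0}"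

definition c00 :: "(nat \<Rightarrow> real) set" where
  "c00 = {x. x 0 = 0 \<and> finite (supp x)}"

text \<open>The inclusion of \<^const>\<open>c00\<close> into the space with basis \<open>e\<close>.\<close>

definition basis_vec :: "(nat \<Rightarrow> 'a::real_vector) \<Rightarrow> (nat \<Rightarrow> real) \<Rightarrow> 'a" where
  "basis_vec e x = (\<Sum>j\<in>supp x. x j *\<^sub>R e j)"

definition schreier1 :: "nat set set" where
  "schreier1 = {F. finite F \<and> F \<subseteq> {1..} \<and> (F = {} \<or> card F \<le> Min F)}"

definition S1_allowable :: "nat \<Rightarrow> (nat \<Rightarrow> nat set) \<Rightarrow> bool" where
  "S1_allowable n E \<longleftrightarrow>
     (\<forall>i\<in>{1..n}. finite (E i) \<and> E i \<noteq> {} \<and> E i \<subseteq> {1..}) \<and>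
     disjoint_family_on E {1..n} \<and>
     (\<lambda>i. Min (E i)) ` {1..n} \<in> schreier1"


section \<open>Asymptotic \<open>\<ell>\<^sub>p\<close> spaces for vectors with disjoint supports\<close>

definition lp_norm :: "real \<Rightarrow> nat \<Rightarrow> (nat \<Rightarrow> real) \<Rightarrow> real" where
  "lp_norm p n a = (\<Sum>i=1..n. \<bar>a i\<bar> powr p) powr (1 / p)"

definition lp_equivalent :: "real \<Rightarrow> real \<Rightarrow> nat \<Rightarrow> (nat \<Rightarrow> 'a::real_normed_vector) \<Rightarrow> bool" where
  "lp_equivalent C p n x \<longleftrightarrow>
     (\<exists>A>0. \<exists>B>0. A * B \<le> C \<and>
        (\<forall>a::nat \<Rightarrow> real.
           1 / A * lp_norm p n a \<le> norm (\<Sum>i=1..n. a i *\<^sub>R x i) \<and>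
           norm (\<Sum>i=1..n. a i *\<^sub>R x i) \<le> B * lp_norm p n a))"

definition asymptotic_lp_disjoint :: "real \<Rightarrow> (nat \<Rightarrow> 'a::banach) \<Rightarrow> bool" where
  "asymptotic_lp_disjoint p e \<longleftrightarrow>
     (\<exists>C>0. \<forall>n. \<forall>x::nat \<Rightarrow> nat \<Rightarrow> real.
        (\<forall>i\<in>{1..n}. x i \<in> c00 \<and> norm (basis_vec e (x i)) = 1) \<and>
        S1_allowable n (\<lambda>i. supp (x i)) \<longrightarrow>
        lp_equivalent C p n (\<lambda>i. basis_vec e (x i)))"


section \<open>Weak Hilbert spaces\<close>

text \<open>The space $\ell_2^k$ is carried by the sequences supported in $\{1, \dots, k\}$, because
  its dimension varies inside the definitions; its norm is \<open>\<lambda>v. L2_set v {1..k}\<close>.\<close>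

definition ell2 :: "nat \<Rightarrow> (nat \<Rightarrow> real) set" where
  "ell2 k = {v. \<forall>i. i \<notin> {1..k} \<longrightarrow> v i = 0}"

definition ell2_iso :: "'a::real_normed_vector set \<Rightarrow> nat \<Rightarrow> ('a \<Rightarrow> nat \<Rightarrow> real) \<Rightarrow> bool" where
  "ell2_iso F k T \<longleftrightarrow> bij_betw T F (ell2 k) \<and>
     (\<forall>x\<in>F. \<forall>y\<in>F. \<forall>a b::real. T (a *\<^sub>R x + b *\<^sub>R y) = (\<lambda>i. a * T x i + b * T y i))"

text \<open>The operator norms of \<open>T : F \<rightarrow> \<ell>\<^sub>2\<^sup>k\<close> and of its inverse. The suprema are finite, since
  they are only used for finite dimensional \<open>F\<close>.\<close>

definition iso_norm :: "'a::real_normed_vector set \<Rightarrow> nat \<Rightarrow> ('a \<Rightarrow> nat \<Rightarrow> real) \<Rightarrow> real" where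
  "iso_norm F k T = (SUP x\<in>{x\<in>F. norm x \<le> 1}. L2_set (T x) {1..k})"

definition iso_inv_norm :: "'a::real_normed_vector set \<Rightarrow> nat \<Rightarrow> ('a \<Rightarrow> nat \<Rightarrow> real) \<Rightarrow> real" where
  "iso_inv_norm F k T = (SUP v\<in>{v\<in>ell2 k. L2_set v {1..k} \<le> 1}. norm (inv_into F T v))"

text \<open>The Banach-Mazur distance between a finite dimensional subspace \<open>F\<close> and the Euclidean
  space of the same dimension.\<close>

definition bm_dist_ell2 :: "'a::real_normed_vector set \<Rightarrow> real" where
  "bm_dist_ell2 F =
     (INF T\<in>{T. ell2_iso F (dim F) T}. iso_norm F (dim F) T * iso_inv_norm F (dim F) T)"

definition fin_dim_subspace :: "'a::real_vector set \<Rightarrow> bool" where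
  "fin_dim_subspace E \<longleftrightarrow> (\<exists>B. finite B \<and> E = span B)"

definition projection_onto :: "('a::real_normed_vector \<Rightarrow> 'a) \<Rightarrow> 'a set \<Rightarrow> bool" where
  "projection_onto P F \<longleftrightarrow> bounded_linear P \<and> range P = F \<and> (\<forall>x\<in>F. P x = x)"

definition weak_hilbert_space :: "'a::banach itself \<Rightarrow> bool" where
  "weak_hilbert_space (X :: 'a itself) \<longleftrightarrow>
     (\<exists>\<delta>>0. \<exists>C\<ge>1. \<forall>E::'a set. fin_dim_subspace E \<longrightarrow>
        (\<exists>F P. subspace F \<and> F \<subseteq> E \<and> projection_onto P F \<and>
           real (dim F) \<ge> \<delta> * real (dim E) \<and> bm_dist_ell2 F \<le> C \<and> onorm P \<le> C))"

end

theory Submission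
  imports Defs "HOL-Real_Asymp.Real_Asymp"
begin

text \<open>
  Let \<open>dim E = N\<close> and \<open>n = N div 2\<close>. The vectors of \<open>E\<close> whose first \<open>n\<close> coordinates vanish form a
  subspace of dimension at least \<open>n\<close>; take an \<open>n\<close>-dimensional subspace \<open>F\<close> of it. Applying the
  asymptotic condition repeatedly, to unions of sets grouped by their minima, shows that any
  partition of a finite subset of \<open>{n..}\<close> into at most doubly exponentially many sets splits the norm
  into an \<open>\<ell>\<^sub>2\<close>-sum, up to a constant. A basis \<open>x\<^sub>1, \<dots>, x\<^sub>n\<close> of \<open>F\<close> whose coordinate functionals have
  norm at most \<open>5\<^sup>n\<close> allows a partition with so few sets \<open>S\<close> such that on each \<open>S\<close> all of \<open>F\<close> is
  almost proportional to \<open>u = \<Sum>\<^sub>i \<bar>x\<^sub>i\<bar>\<close>. With functionals \<open>\<phi>\<^sub>S\<close> that norm \<open>u\<bar>\<^sub>S\<close>, the form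
  \<open>\<Sum>\<^sub>S \<phi>\<^sub>S(x\<bar>\<^sub>S) \<phi>\<^sub>S(y\<bar>\<^sub>S)\<close> is bounded on the whole space and equivalent to the squared norm on \<open>F\<close>,
  so that \<open>F\<close> is Hilbertian and the orthogonal projection onto it is bounded. The finitely many
  small \<open>N\<close> need only a one-dimensional \<open>F\<close>.
\<close>

section \<open>Norming functionals\<close>

definition sublinear :: "('a::real_vector \<Rightarrow> real) \<Rightarrow> bool" where
  "sublinear q \<longleftrightarrow> (\<forall>x y. q (x + y) \<le> q x + q y) \<and> (\<forall>t\<ge>0. \<forall>x. q (t *\<^sub>R x) = t * q x)"

lemma sublinear_zero: "sublinear q \<Longrightarrow> q 0 = 0"
  unfolding sublinear_def by (metis mult_zero_left order_refl scaleR_zero_left)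

lemma sublinear_minus: "sublinear q \<Longrightarrow> - q (- x) \<le> q x"
  using sublinear_zero[of q] unfolding sublinear_def
  by (metis add.right_inverse add_le_cancel_left add.commute diff_minus_eq_add diff_0 diff_le_eq)

text \<open>The one-step modification of the Hahn-Banach argument: still sublinear and below
  \<open>q\<close>, but at \<open>- v\<close> it is at most \<open>- q v\<close> (take
  \<open>t = 1\<close>), so any linear functional below it is at least \<open>q v\<close> at
  \<open>v\<close>.\<close>

definition lower_along :: "('a::real_vector \<Rightarrow> real) \<Rightarrow> 'a \<Rightarrow> 'a \<Rightarrow> real" where
  "lower_along q v x = (INF t\<in>{0..}. q (x + t *\<^sub>R v) - t * q v)"

text \<open>The bound \<open>- q (- x)\<close> keeps the infimum finite. Subadditivity holds because
  the parameters \<open>s\<close> and \<open>t\<close> of two competitors add up, homogeneity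
  because the parameter can be rescaled.\<close>

lemma
  assumes q: "sublinear q"
  shows lower_along_le: "t \<ge> 0 \<Longrightarrow> lower_along q v x \<le> q (x + t *\<^sub>R v) - t * q v"
    and sublinear_lower_along: "sublinear (lower_along q v)"
proof -
  have add: "q (x + y) \<le> q x + q y" for x y using q by (auto simp: sublinear_def)
  have hom: "t \<ge> 0 \<Longrightarrow> q (t *\<^sub>R x) = t * q x" for t x using q by (auto simp: sublinear_def)
  have lb: "- q (- x) \<le> q (x + t *\<^sub>R v) - t * q v" if "t \<ge> 0" for t x
    using add[of "x + t *\<^sub>R v" "- x"] hom[OF that, of v] by simp
  have bdd: "bdd_below ((\<lambda>t. q (x + t *\<^sub>R v) - t * q v) ` {0..})" for x
    by (rule bdd_belowI2[where m = "- q (- x)"]) (use lb in auto)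
  show le: "lower_along q v x \<le> q (x + t *\<^sub>R v) - t * q v" if "t \<ge> 0" for t x
    unfolding lower_along_def by (rule cINF_lower[OF bdd]) (use that in auto)
  have ge: "c \<le> lower_along q v x" if "\<And>t. t \<ge> 0 \<Longrightarrow> c \<le> q (x + t *\<^sub>R v) - t * q v" for c x
    unfolding lower_along_def by (rule cINF_greatest) (use that in auto)
  have sub: "lower_along q v (x + y) \<le> lower_along q v x + lower_along q v y" for x y
  proof -
    have "lower_along q v (x + y) - lower_along q v x \<le> lower_along q v y"
    proof (rule ge)
      fix t :: real assume t: "t \<ge> 0"
      have "lower_along q v (x + y) - (q (y + t *\<^sub>R v) - t * q v) \<le> lower_along q v x"
      proof (rule ge)
        fix s :: real assume s: "s \<ge> 0"
        have "lower_along q v (x + y) \<le> q ((x + y) + (s + t) *\<^sub>R v) - (s + t) * q v"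
          using le s t by simp
        also have "(x + y) + (s + t) *\<^sub>R v = (x + s *\<^sub>R v) + (y + t *\<^sub>R v)"
          by (simp add: algebra_simps)
        finally show "lower_along q v (x + y) - (q (y + t *\<^sub>R v) - t * q v)
            \<le> q (x + s *\<^sub>R v) - s * q v"
          using add[of "x + s *\<^sub>R v" "y + t *\<^sub>R v"] by (simp add: algebra_simps)
      qed
      then show "lower_along q v (x + y) - lower_along q v x \<le> q (y + t *\<^sub>R v) - t * q v" by simp
    qed
    then show ?thesis by simp
  qed
  have scale_le: "lower_along q v (s *\<^sub>R x) \<le> s * lower_along q v x" if "s > 0" for s x
  proof -
    have "lower_along q v (s *\<^sub>R x) / s \<le> lower_along q v x"
    proof (rule ge)
      fix t :: real assume t: "t \<ge> 0"
      have "lower_along q v (s *\<^sub>R x) \<le> q (s *\<^sub>R x + (s * t) *\<^sub>R v) - (s * t) * q v"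
        using le t that by simp
      also have "s *\<^sub>R x + (s * t) *\<^sub>R v = s *\<^sub>R (x + t *\<^sub>R v)" by (simp add: algebra_simps)
      also have "q (s *\<^sub>R (x + t *\<^sub>R v)) = s * q (x + t *\<^sub>R v)" using hom that by simp
      finally show "lower_along q v (s *\<^sub>R x) / s \<le> q (x + t *\<^sub>R v) - t * q v"
        using that by (simp add: field_simps)
    qed
    then show ?thesis using that by (simp add: field_simps)
  qed
  have zero: "lower_along q v 0 = 0"
  proof (rule antisym)
    show "lower_along q v 0 \<le> 0" using le[of 0 0] sublinear_zero[OF q] by simp
    show "0 \<le> lower_along q v 0" by (rule ge) (simp add: hom)
  qed
  have "lower_along q v (s *\<^sub>R x) = s * lower_along q v x" if "s \<ge> 0" for s x
  proof (cases "s = 0")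
    case False
    with that have s: "s > 0" by simp
    \<comment> \<open>The reverse inequality is \<open>scale_le\<close> for the inverse
      factor.\<close>
    have "lower_along q v (inverse s *\<^sub>R (s *\<^sub>R x)) \<le> inverse s * lower_along q v (s *\<^sub>R x)"
      using s by (intro scale_le) simp
    then have "s * lower_along q v x \<le> lower_along q v (s *\<^sub>R x)"
      using s by (simp add: field_simps)
    with scale_le[OF s] show ?thesis by (intro antisym) auto
  qed (simp add: zero)
  with sub show "sublinear (lower_along q v)" by (simp add: sublinear_def)
qed

text \<open>A sublinear functional that is minimal among the sublinear functionals is additive, since
  it cannot be lowered along any direction.\<close>

lemma sublinear_dominates_linear:
  fixes p :: "'a::real_vector \<Rightarrow> real"
  assumes p: "sublinear p"
  obtains f where "linear f" "\<And>x. f x \<le> p x"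
proof -
  define A where "A = {q. sublinear q \<and> (\<forall>x. q x \<le> p x)}"
  define R where "R = (\<lambda>q r :: 'a \<Rightarrow> real. \<forall>x. r x \<le> q x)"
  have lbA: "- p (- x) \<le> q x" if "q \<in> A" for q x
    using sublinear_minus[of q x] that unfolding A_def
    by (smt (verit) mem_Collect_eq)
  \<comment> \<open>\<open>R q r\<close> says that \<open>r\<close> lies below \<open>q\<close>, so
    an \<open>R\<close>-maximal element is a minimal sublinear functional. Chains are bounded by
    their pointwise infimum, which is finite by the common lower bound
    \<open>- p (- x)\<close>.\<close>
  have "\<exists>m\<in>A. \<forall>a\<in>A. R m a \<longrightarrow> a = m"
  proof (rule predicate_Zorn)
    show "partial_order_on A (relation_of R A)"
      by (rule partial_order_on_relation_ofI)
        (auto simp: R_def intro!: ext intro: order_trans order_antisym)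
  next
    fix Ch assume Ch: "Ch \<in> Chains (relation_of R A)"
    then have sub: "Ch \<subseteq> A" and comp: "\<And>q r. q \<in> Ch \<Longrightarrow> r \<in> Ch \<Longrightarrow> R q r \<or> R r q"
      unfolding Chains_def relation_of_def by auto
    show "\<exists>u\<in>A. \<forall>a\<in>Ch. R a u"
    proof (cases "Ch = {}")
      case True
      then show ?thesis using p by (auto simp: A_def)
    next
      case False
      define u where "u = (\<lambda>x. INF q\<in>Ch. q x)"
      have bdd: "bdd_below ((\<lambda>q. q x) ` Ch)" for x
        by (rule bdd_belowI2[where m = "- p (- x)"]) (use lbA sub in auto)
      have le: "u x \<le> q x" if "q \<in> Ch" for q x
        unfolding u_def by (rule cINF_lower[OF bdd that])
      have ge: "c \<le> u x" if "\<And>q. q \<in> Ch \<Longrightarrow> c \<le> q x" for c x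
        unfolding u_def by (rule cINF_greatest[OF False that])
      \<comment> \<open>Of two members of the chain, the smaller one can serve for both
        summands.\<close>
      have chain_add: "u (x + y) \<le> q x + r y" if "q \<in> Ch" "r \<in> Ch" for q r x y
      proof -
        have *: "s (x + y) \<le> s x + s y" if "s \<in> Ch" for s
          using sub that by (auto simp: A_def sublinear_def)
        from comp[OF that] show ?thesis
        proof
          assume "R q r"
          then have "r x \<le> q x" by (simp add: R_def)
          with le[OF that(2)] *[OF that(2)] show ?thesis by (smt (verit))
        next
          assume "R r q"
          then have "q y \<le> r y" by (simp add: R_def)
          with le[OF that(1)] *[OF that(1)] show ?thesis by (smt (verit))
        qed
      qed
      have "u (x + y) \<le> u x + u y" for x y
      proof -
        have "u (x + y) - u x \<le> u y"
        proof (rule ge)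
          fix r assume r: "r \<in> Ch"
          have "u (x + y) - r y \<le> u x"
            by (rule ge) (use chain_add[OF _ r, of _ x y] in \<open>simp add: algebra_simps\<close>)
          then show "u (x + y) - u x \<le> r y" by simp
        qed
        then show ?thesis by simp
      qed
      moreover have "u (t *\<^sub>R x) = t * u x" if "t \<ge> 0" for t x
      proof (cases "t = 0")
        case True
        have "q 0 = 0" if "q \<in> Ch" for q
          using sub that sublinear_zero by (auto simp: A_def)
        moreover obtain q where "q \<in> Ch" using \<open>Ch \<noteq> {}\<close> by auto
        ultimately have "u 0 = 0" using le[of q 0] ge[of 0 0] by (smt (verit))
        with True show ?thesis by simp
      next
        case False
        with that have t: "t > 0" by simp
        have h: "q (t *\<^sub>R x) = t * q x" if "q \<in> Ch" for q
          using sub that t by (auto simp: A_def sublinear_def)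
        show ?thesis
        proof (rule antisym)
          have "u (t *\<^sub>R x) / t \<le> u x"
            by (rule ge) (use le[of _ "t *\<^sub>R x"] h t in \<open>auto simp: field_simps\<close>)
          then show "u (t *\<^sub>R x) \<le> t * u x" using t by (simp add: field_simps)
          show "t * u x \<le> u (t *\<^sub>R x)"
            by (rule ge) (use le[of _ x] t in \<open>simp add: h mult_left_mono\<close>)
        qed
      qed
      ultimately have "sublinear u" by (simp add: sublinear_def)
      moreover have "u x \<le> p x" for x
      proof -
        obtain q where "q \<in> Ch" using False by auto
        then have "u x \<le> q x" "q x \<le> p x" using le sub by (auto simp: A_def)
        then show ?thesis by simp
      qed
      ultimately show ?thesis using le by (auto simp: A_def R_def)
    qed
  qed
  then obtain m where m: "m \<in> A" and min: "\<And>q. q \<in> A \<Longrightarrow> R m q \<Longrightarrow> q = m" by blast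
  then have sm: "sublinear m" by (simp add: A_def)
  \<comment> \<open>The half of additivity that sublinearity does not give: with
    \<open>lower_along m v = m\<close>, the defining bound at \<open>t = 1\<close> is exactly this
    inequality.\<close>
  have "m x + m v \<le> m (x + v)" for x v
  proof -
    have lem: "lower_along m v y \<le> m y" for y using lower_along_le[OF sm, of 0 v y] by simp
    have "lower_along m v \<in> A"
      using m lem sublinear_lower_along[OF sm] order_trans by (fastforce simp: A_def)
    moreover have "R m (lower_along m v)" using lem by (simp add: R_def)
    ultimately have "lower_along m v = m" by (rule min)
    then show ?thesis using lower_along_le[OF sm, of 1 v x] by simp
  qed
  then have add: "m (x + y) = m x + m y" for x y
    using sm by (intro antisym) (auto simp: sublinear_def)
  have neg: "m (- x) = - m x" for x
    using add[of x "- x"] sublinear_zero[OF sm] by simp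
  have "m (t *\<^sub>R x) = t * m x" for t x
  proof (cases "t \<ge> 0")
    case False
    then have "m ((- t) *\<^sub>R x) = (- t) * m x" using sm unfolding sublinear_def
      by (metis linorder_linear neg_0_le_iff_le)
    then show ?thesis using neg[of "t *\<^sub>R x"] by simp
  qed (use sm in \<open>auto simp: sublinear_def\<close>)
  with add have "linear m" by (intro linearI) auto
  with m show thesis by (intro that[of m]) (auto simp: A_def)
qed

text \<open>The norm is first lowered along \<open>u\<close>. A linear functional below the result
  is still dominated by the norm, and its value at \<open>- u\<close> is forced down to at most
  \<open>- norm u\<close>.\<close>

lemma norming_functional:
  fixes u :: "'a::real_normed_vector"
  obtains f :: "'a \<Rightarrow> real" where "linear f" "\<And>x. \<bar>f x\<bar> \<le> norm x" "f u = norm u"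
proof -
  have sn: "sublinear (norm :: 'a \<Rightarrow> real)" by (auto simp: sublinear_def norm_triangle_ineq)
  obtain f where f: "linear f" "\<And>x. f x \<le> lower_along norm u x"
    using sublinear_dominates_linear[OF sublinear_lower_along[OF sn, of u]] by blast
  have le: "f x \<le> norm x" for x
    using f(2)[of x] lower_along_le[OF sn, of 0 u x] by simp
  have "\<bar>f x\<bar> \<le> norm x" for x
    using le[of x] le[of "- x"] linear_neg[OF f(1), of x] by simp
  moreover have "norm u \<le> f u"
    using f(2)[of "- u"] lower_along_le[OF sn, of 1 u "- u"] linear_neg[OF f(1), of u] by simp
  ultimately show thesis using f(1) le[of u] by (intro that[of f]) auto
qed

section \<open>Subspaces dominated by a bilinear form\<close>

lemma orthonormal_expansion:
  fixes B :: "'a::real_vector \<Rightarrow> 'a \<Rightarrow> real"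
  assumes B: "bilinear B"
    and f: "\<And>i j. i \<in> I \<Longrightarrow> j \<in> I \<Longrightarrow> B (f i) (f j) = (if i = j then 1 else 0)"
    and "finite I" and x: "x \<in> span (f ` I)"
  shows "(\<Sum>i\<in>I. B (f i) x *\<^sub>R f i) = x"
  using x
proof (induction rule: span_induct)
  case base
  show ?case
    unfolding subspace_def
    by (auto simp: bilinear_rzero[OF B] bilinear_radd[OF B] bilinear_rmul[OF B] scaleR_add_left
        sum.distrib scaleR_right.sum[symmetric] simp flip: scaleR_scaleR)
next
  case (step x)
  then obtain j where j: "j \<in> I" "x = f j" by auto
  have "(\<Sum>i\<in>I. B (f i) (f j) *\<^sub>R f i) = (\<Sum>i\<in>I. if i = j then f j else 0)"
    using j f by (intro sum.cong) auto
  with j \<open>finite I\<close> show ?case by simp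
qed

text \<open>A vector of \<open>S\<close> that depends on the earlier ones leaves residual 0 and
  contributes nothing, so \<open>S\<close> may be dependent and \<open>k\<close> is left
  open.\<close>

lemma gram_schmidt:
  fixes B :: "'a::real_vector \<Rightarrow> 'a \<Rightarrow> real"
  assumes B: "bilinear B" and sym: "\<And>x y. B x y = B y x"
    and "finite S" and "\<And>x. x \<in> span S \<Longrightarrow> x \<noteq> 0 \<Longrightarrow> B x x > 0"
  shows "\<exists>(k::nat) f. (\<forall>i\<in>{1..k}. \<forall>j\<in>{1..k}. B (f i) (f j) = (if i = j then 1 else 0))
    \<and> span (f ` {1..k}) = span S"
  using assms(3,4)
proof (induction S rule: finite_induct)
  case empty
  then show ?case by (intro exI[of _ 0] exI[of _ "\<lambda>_. 0"]) auto
next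
  case (insert b S)
  have "span S \<subseteq> span (insert b S)" by (rule span_mono) auto
  with insert.IH insert.prems obtain k f where
    f: "\<forall>i\<in>{1..k}. \<forall>j\<in>{1..k}. B (f i) (f j) = (if i = j then 1 else 0)"
    and span: "span (f ` {1..k::nat}) = span S" by blast
  define p where "p = (\<Sum>i=1..k. B (f i) b *\<^sub>R f i)"
  define r where "r = b - p"
  have p: "p \<in> span S"
    unfolding p_def span[symmetric] by (intro span_sum span_scale span_base) auto
  have spanr: "span (insert r S) = span (insert b S)"
  proof -
    have "r \<in> span (insert b S)" unfolding r_def
      using p \<open>span S \<subseteq> span (insert b S)\<close> by (blast intro: span_diff span_base)
    moreover have "b \<in> span (insert r S)"
    proof -
      have "span S \<subseteq> span (insert r S)" by (rule span_mono) auto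
      with p have "r + p \<in> span (insert r S)" by (blast intro: span_add span_base)
      then show ?thesis by (simp add: r_def)
    qed
    ultimately show ?thesis
      by (intro span_eq[THEN iffD2]) (auto intro: span_base)
  qed
  have orth: "B (f j) r = 0" if j: "j \<in> {1..k}" for j
  proof -
    have "B (f j) p = (\<Sum>i=1..k. B (f i) b * B (f j) (f i))"
      unfolding p_def using B by (simp add: bilinear_def linear_sum linear_cmul)
    also have "\<dots> = (\<Sum>i=1..k. if i = j then B (f j) b else 0)"
      using f j by (intro sum.cong) auto
    finally have "B (f j) p = B (f j) b" using j by simp
    then show ?thesis by (simp add: r_def bilinear_rsub[OF B])
  qed
  show ?case
  proof (cases "r = 0")
    case True
    with spanr span have "span (f ` {1..k}) = span (insert b S)"
      by (metis span_insert_0)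
    with f show ?thesis by blast
  next
    case False
    have r: "r \<in> span (insert b S)" using spanr by (metis insertI1 span_base)
    with False insert.prems have pos: "B r r > 0" by blast
    define c where "c = 1 / sqrt (B r r)"
    have c: "c \<noteq> 0" "c * c * B r r = 1" using pos by (auto simp: c_def)
    define g where "g = f(Suc k := c *\<^sub>R r)"
    have "\<forall>i\<in>{1..Suc k}. \<forall>j\<in>{1..Suc k}. B (g i) (g j) = (if i = j then 1 else 0)"
    proof (intro ballI)
      fix i j assume ij: "i \<in> {1..Suc k}" "j \<in> {1..Suc k}"
      have rf: "B r (f i) = 0" if "i \<in> {1..k}" for i using orth[OF that] sym by metis
      from ij f orth rf c show "B (g i) (g j) = (if i = j then 1 else 0)"
        by (cases "i = Suc k"; cases "j = Suc k")
          (auto simp: g_def bilinear_lmul[OF B] bilinear_rmul[OF B] mult.assoc)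
    qed
    moreover have "span (g ` {1..Suc k}) = span (insert b S)"
    proof -
      have "g ` {1..Suc k} = insert (c *\<^sub>R r) (f ` {1..k})"
        by (force simp: g_def image_iff)
      also have "span \<dots> = span (insert r S)"
      proof (rule span_eq[THEN iffD2], intro conjI)
        have S: "span S \<subseteq> span (insert r S)" by (rule span_mono) auto
        have fS: "f ` {1..k} \<subseteq> span S" using span by (metis span_superset)
        show "insert (c *\<^sub>R r) (f ` {1..k}) \<subseteq> span (insert r S)"
          using S fS by (blast intro: span_scale span_base)
        have "span (f ` {1..k}) \<subseteq> span (insert (c *\<^sub>R r) (f ` {1..k}))" by (rule span_mono) auto
        then have "S \<subseteq> span (insert (c *\<^sub>R r) (f ` {1..k}))"
          unfolding span using span_superset by blast
        moreover have "inverse c *\<^sub>R c *\<^sub>R r \<in> span (insert (c *\<^sub>R r) (f ` {1..k}))"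
          by (intro span_scale span_base) auto
        ultimately show "insert r S \<subseteq> span (insert (c *\<^sub>R r) (f ` {1..k}))"
          using c by simp
      qed
      finally show ?thesis using spanr by simp
    qed
    ultimately show ?thesis by blast
  qed
qed

section \<open>Linear isomorphisms onto Euclidean space\<close>

lemma ell2_iso_sum:
  assumes T: "ell2_iso F k T" and F: "subspace F"
    and "finite I" and "\<And>i. i \<in> I \<Longrightarrow> g i \<in> F"
  shows "T (\<Sum>i\<in>I. c i *\<^sub>R g i) = (\<lambda>j. \<Sum>i\<in>I. c i * T (g i) j)"
  using assms(3,4)
proof (induction I rule: finite_induct)
  case empty
  have "T (0 *\<^sub>R 0 + 0 *\<^sub>R 0) = (\<lambda>i. 0 * T 0 i + 0 * T 0 i)"
    using T subspace_0[OF F] unfolding ell2_iso_def by blast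
  then show ?case by simp
next
  case (insert a I)
  have "(\<Sum>i\<in>I. c i *\<^sub>R g i) \<in> F" using insert by (intro subspace_sum[OF F] subspace_scale[OF F]) auto
  then have "T (c a *\<^sub>R g a + 1 *\<^sub>R (\<Sum>i\<in>I. c i *\<^sub>R g i))
      = (\<lambda>j. c a * T (g a) j + 1 * T (\<Sum>i\<in>I. c i *\<^sub>R g i) j)"
    using T insert.prems unfolding ell2_iso_def by blast
  then show ?case using insert by simp
qed

lemma L2_set_coord_le: "finite I \<Longrightarrow> i \<in> I \<Longrightarrow> \<bar>f i\<bar> \<le> L2_set f I"
  using member_le_L2_set[of I i "\<lambda>i. \<bar>f i\<bar>"] by (simp add: L2_set_def)

text \<open>A real supremum can be compared with the value at 0 only once the set is bounded above.
  For \<open>T\<close> the bound comes from an expansion with bounded coefficients, for its inverse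
  from the preimages of the unit vectors. The result bounds the infimum in
  \<open>bm_dist_ell2\<close> from below.\<close>

lemma ell2_iso_norms_nonneg:
  assumes T: "ell2_iso F k T" and F: "subspace F"
    and "finite I" and gF: "\<And>i. i \<in> I \<Longrightarrow> g i \<in> F"
    and exp: "\<And>x. x \<in> F \<Longrightarrow> x = (\<Sum>i\<in>I. c i x *\<^sub>R g i)"
    and bound: "\<And>x i. x \<in> F \<Longrightarrow> i \<in> I \<Longrightarrow> \<bar>c i x\<bar> \<le> M * norm x"
  shows "0 \<le> iso_norm F k T" and "0 \<le> iso_inv_norm F k T"
proof -
  have bij: "bij_betw T F (ell2 k)" using T by (simp add: ell2_iso_def)
  have T0: "T 0 = (\<lambda>j. 0)" using ell2_iso_sum[OF T F, of "{}"] by simp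
  have "bdd_above ((\<lambda>x. L2_set (T x) {1..k}) ` {x \<in> F. norm x \<le> 1})"
  proof (rule bdd_aboveI2)
    fix x assume x: "x \<in> {x \<in> F. norm x \<le> 1}"
    have "T x = (\<lambda>j. \<Sum>i\<in>I. c i x * T (g i) j)"
      using x exp[of x] ell2_iso_sum[OF T F \<open>finite I\<close>, where g = g and c = "\<lambda>i. c i x"] gF by simp
    then have "L2_set (T x) {1..k} \<le> (\<Sum>j=1..k. \<bar>\<Sum>i\<in>I. c i x * T (g i) j\<bar>)"
      by (simp add: L2_set_le_sum_abs)
    also have "\<dots> \<le> (\<Sum>j=1..k. \<Sum>i\<in>I. \<bar>M\<bar> * \<bar>T (g i) j\<bar>)"
    proof (intro sum_mono order.trans[OF sum_abs])
      fix i j assume "i \<in> I"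
      then have "\<bar>c i x\<bar> \<le> M * norm x" using bound x by auto
      also have "\<dots> \<le> \<bar>M\<bar> * 1" using x by (intro mult_mono) auto
      finally show "\<bar>c i x * T (g i) j\<bar> \<le> \<bar>M\<bar> * \<bar>T (g i) j\<bar>"
        by (simp add: abs_mult mult_right_mono)
    qed
    finally show "L2_set (T x) {1..k} \<le> (\<Sum>j=1..k. \<Sum>i\<in>I. \<bar>M\<bar> * \<bar>T (g i) j\<bar>)" .
  qed
  from cSUP_upper[OF _ this, of 0] show "0 \<le> iso_norm F k T"
    using subspace_0[OF F] T0 by (simp add: iso_norm_def L2_set_def)
  define h where "h = (\<lambda>i. inv_into F T (\<lambda>j. if j = i then 1 else 0))"
  have unit: "(\<lambda>j. if j = i then 1 else 0) \<in> ell2 k" if "i \<in> {1..k}" for i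
    using that by (auto simp: ell2_def)
  have hF: "h i \<in> F" and Th: "T (h i) = (\<lambda>j. if j = i then 1 else 0)" if "i \<in> {1..k}" for i
    using unit[OF that] bij unfolding h_def bij_betw_def
    by (auto intro: inv_into_into f_inv_into_f)
  have "bdd_above ((\<lambda>v. norm (inv_into F T v)) ` {v \<in> ell2 k. L2_set v {1..k} \<le> 1})"
  proof (rule bdd_aboveI2)
    fix v assume v: "v \<in> {v \<in> ell2 k. L2_set v {1..k} \<le> 1}"
    define y where "y = (\<Sum>i=1..k. v i *\<^sub>R h i)"
    have y: "y \<in> F" unfolding y_def using hF by (intro subspace_sum[OF F] subspace_scale[OF F]) auto
    have "T y = (\<lambda>j. \<Sum>i=1..k. v i * T (h i) j)"
      unfolding y_def using hF by (intro ell2_iso_sum[OF T F]) auto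
    also have "\<dots> = (\<lambda>j. \<Sum>i=1..k. if i = j then v i else 0)"
      using Th by (intro ext sum.cong) auto
    also have "\<dots> = v" using v by (auto simp: ell2_def)
    finally have "inv_into F T v = y" using y bij by (metis bij_betw_def inv_into_f_f)
    moreover have "norm y \<le> (\<Sum>i=1..k. norm (h i))"
      unfolding y_def
    proof (intro sum_norm_le)
      fix i assume "i \<in> {1..k}"
      then have "\<bar>v i\<bar> \<le> 1" using L2_set_coord_le[of "{1..k}" i v] v by force
      then show "norm (v i *\<^sub>R h i) \<le> norm (h i)" by (simp add: mult_left_le_one_le)
    qed
    ultimately show "norm (inv_into F T v) \<le> (\<Sum>i=1..k. norm (h i))" by simp
  qed
  moreover have "(\<lambda>j. 0) \<in> {v \<in> ell2 k. L2_set v {1..k} \<le> 1}" by (simp add: ell2_def L2_set_def)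
  ultimately have "norm (inv_into F T (\<lambda>j. 0)) \<le> iso_inv_norm F k T"
    unfolding iso_inv_norm_def by (intro cSUP_upper)
  then show "0 \<le> iso_inv_norm F k T" using norm_ge_zero order_trans by blast
qed

text \<open>A bounded form that dominates the norm on a finite dimensional subspace yields both the
  isomorphism to Hilbert space and, as orthogonal projection, the projection onto the subspace.\<close>

lemma hilbertian_complemented:
  fixes B :: "'a::real_normed_vector \<Rightarrow> 'a \<Rightarrow> real"
  assumes B: "bilinear B" and sym: "\<And>x y. B x y = B y x"
    and psd: "\<And>x. 0 \<le> B x x" and upper: "\<And>x. B x x \<le> M\<^sup>2 * (norm x)\<^sup>2"
    and "finite S" and lower: "\<And>x. x \<in> span S \<Longrightarrow> (norm x)\<^sup>2 \<le> L\<^sup>2 * B x x"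
    and "M \<ge> 0" "L \<ge> 0"
  obtains P where "projection_onto P (span S)" "onorm P \<le> L * M"
    "bm_dist_ell2 (span S) \<le> L * M"
proof -
  have pos: "B x x > 0" if x: "x \<in> span S" "x \<noteq> 0" for x
  proof -
    have "(norm x)\<^sup>2 > 0" using x by simp
    with lower[OF x(1)] psd[of x] show ?thesis
      by (metis linorder_not_less mult_zero_right order_le_less)
  qed
  from gram_schmidt[OF B sym \<open>finite S\<close> pos] obtain k f where
    f: "\<And>i j. i \<in> {1..k} \<Longrightarrow> j \<in> {1..k} \<Longrightarrow> B (f i) (f j) = (if i = j then 1 else 0)"
    and span: "span (f ` {1..k::nat}) = span S" by blast
  define P where "P = (\<lambda>x. \<Sum>i=1..k. B (f i) x *\<^sub>R f i)"
  have fS: "f i \<in> span S" if "i \<in> {1..k}" for i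
    using that span by (metis image_eqI span_base)
  have PS: "P x \<in> span S" for x unfolding P_def by (intro span_sum span_scale fS)
  have Pid: "P x = x" if "x \<in> span S" for x
    unfolding P_def by (rule orthonormal_expansion[OF B f]) (use that span in auto)
  have BP: "B y (P x) = (\<Sum>i=1..k. B (f i) x * B y (f i))" for x y
    unfolding P_def using B by (simp add: bilinear_def linear_sum linear_cmul)
  have BfP: "B (f j) (P x) = B (f j) x" if "j \<in> {1..k}" for x j
  proof -
    have "(\<Sum>i=1..k. B (f i) x * B (f j) (f i)) = (\<Sum>i=1..k. if i = j then B (f j) x else 0)"
      using f that by (intro sum.cong) auto
    then show ?thesis using that by (simp add: BP)
  qed
  have BPP: "B (P x) (P x) = (\<Sum>i=1..k. (B (f i) x)\<^sup>2)" for x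
    unfolding BP[of "P x"] using BfP sym[of "P x"]
    by (intro sum.cong) (auto simp: power2_eq_square)
  \<comment> \<open>Bessel's inequality, from positivity of the form at
    \<open>x - P x\<close>.\<close>
  have bessel: "(\<Sum>i=1..k. (B (f i) x)\<^sup>2) \<le> B x x" for x
  proof -
    have "B x (P x) = (\<Sum>i=1..k. (B (f i) x)\<^sup>2)"
      unfolding BP using sym[of x] by (simp add: power2_eq_square)
    moreover have "0 \<le> B (x - P x) (x - P x)" by (rule psd)
    ultimately show ?thesis
      using BPP[of x] sym[of "P x" x]
      by (simp add: bilinear_lsub[OF B] bilinear_rsub[OF B])
  qed
  have Bsqrt: "sqrt (B x x) \<le> M * norm x" for x
    using upper[of x] \<open>M \<ge> 0\<close> by (simp add: real_le_lsqrt power_mult_distrib)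
  have normP: "norm (P x) \<le> L * M * norm x" for x
  proof -
    have "(norm (P x))\<^sup>2 \<le> L\<^sup>2 * B (P x) (P x)" by (rule lower[OF PS])
    also have "\<dots> \<le> L\<^sup>2 * (M\<^sup>2 * (norm x)\<^sup>2)"
      unfolding BPP by (intro mult_left_mono order.trans[OF bessel upper]) auto
    finally have "(norm (P x))\<^sup>2 \<le> (L * M * norm x)\<^sup>2" by (simp add: power_mult_distrib mult.assoc)
    then show ?thesis using \<open>M \<ge> 0\<close> \<open>L \<ge> 0\<close> by (auto intro: power2_le_imp_le[OF _ mult_nonneg_nonneg])
  qed
  have "bounded_linear P"
  proof (rule bounded_linear_intro)
    show "P (x + y) = P x + P y" for x y
      by (simp add: P_def bilinear_radd[OF B] scaleR_add_left sum.distrib)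
    show "P (r *\<^sub>R x) = r *\<^sub>R P x" for r x
      by (simp add: P_def bilinear_rmul[OF B] scaleR_right.sum)
    show "norm (P x) \<le> norm x * (L * M)" for x using normP[of x] by (simp add: mult.commute)
  qed
  moreover have "range P = span S"
    using PS Pid by (auto simp: image_iff) metis
  ultimately have proj: "projection_onto P (span S)"
    using Pid by (simp add: projection_onto_def)
  \<comment> \<open>\<open>bm_dist_ell2\<close> refers to \<open>dim\<close>, so the length of the
    orthonormal system has to be identified with the dimension; orthogonality gives
    independence.\<close>
  have "inj_on f {1..k}" using f by (metis inj_onI zero_neq_one)
  moreover have "independent (f ` {1..k})"
    unfolding dependent_def
  proof (safe)
    fix j assume j: "j \<in> {1..k}" and dep: "f j \<in> span (f ` {1..k} - {f j})"
    have "B (f j) x = 0" if "x \<in> span (f ` {1..k} - {f j})" for x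
      using that
    proof (induction rule: span_induct)
      case base
      show ?case unfolding subspace_def
        by (auto simp: bilinear_rzero[OF B] bilinear_radd[OF B] bilinear_rmul[OF B])
    next
      case (step x)
      with f j show ?case by auto
    qed
    from this[OF dep] show False using f[OF j j] by simp
  qed
  ultimately have dim: "dim (span S) = k"
    using dim_eq_card[of "f ` {1..k}" "span S"] span by (simp add: span_span card_image)
  \<comment> \<open>Coordinates in the orthonormal system, padded by 0 as \<open>ell2\<close>
    demands. On the span the Euclidean norm of \<open>T x\<close> is \<open>sqrt (B x x)\<close>, so
    \<open>M\<close> bounds \<open>T\<close> and \<open>L\<close> bounds its inverse.\<close>
  define T where "T = (\<lambda>x i. if i \<in> {1..k} then B (f i) x else 0)"
  have bij: "bij_betw T (span S) (ell2 k)"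
  proof (rule bij_betw_byWitness[where f' = "\<lambda>v. \<Sum>i=1..k. v i *\<^sub>R f i"])
    show "\<forall>x\<in>span S. (\<Sum>i=1..k. T x i *\<^sub>R f i) = x"
      using Pid by (simp add: T_def P_def)
    show "\<forall>v\<in>ell2 k. T (\<Sum>i=1..k. v i *\<^sub>R f i) = v"
    proof (intro ballI ext)
      fix v j assume v: "v \<in> ell2 k"
      show "T (\<Sum>i=1..k. v i *\<^sub>R f i) j = v j"
      proof (cases "j \<in> {1..k}")
        case True
        have "B (f j) (\<Sum>i=1..k. v i *\<^sub>R f i) = (\<Sum>i=1..k. v i * B (f j) (f i))"
          using B by (simp add: bilinear_def linear_sum linear_cmul)
        also have "\<dots> = (\<Sum>i=1..k. if i = j then v j else 0)"
          using f True by (intro sum.cong) auto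
        finally show ?thesis using True by (simp add: T_def)
      qed (use v in \<open>auto simp: T_def ell2_def\<close>)
    qed
    show "T ` span S \<subseteq> ell2 k" by (auto simp: T_def ell2_def)
    show "(\<lambda>v. \<Sum>i=1..k. v i *\<^sub>R f i) ` ell2 k \<subseteq> span S"
      by (auto intro!: span_sum span_scale fS)
  qed
  have iso: "ell2_iso (span S) k T"
    using bij by (auto simp: ell2_iso_def T_def bilinear_radd[OF B] bilinear_rmul[OF B] fun_eq_iff)
  have LT: "L2_set (T x) {1..k} = sqrt (B x x)" if "x \<in> span S" for x
    using BPP[of x] Pid[OF that] by (simp add: L2_set_def T_def)
  have "iso_norm (span S) k T \<le> M"
    unfolding iso_norm_def
  proof (rule cSUP_least)
    fix x assume x: "x \<in> {x \<in> span S. norm x \<le> 1}"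
    then have "L2_set (T x) {1..k} \<le> M * norm x" using LT Bsqrt by simp
    also have "\<dots> \<le> M * 1" using x \<open>M \<ge> 0\<close> by (intro mult_left_mono) auto
    finally show "L2_set (T x) {1..k} \<le> M" by simp
  qed (auto intro: span_zero)
  moreover have "iso_inv_norm (span S) k T \<le> L"
    unfolding iso_inv_norm_def
  proof (rule cSUP_least)
    show "{v \<in> ell2 k. L2_set v {1..k} \<le> 1} \<noteq> {}"
      by (auto intro!: exI[of _ "\<lambda>_. 0"] simp: ell2_def L2_set_def)
    fix v assume v: "v \<in> {v \<in> ell2 k. L2_set v {1..k} \<le> 1}"
    define x where "x = inv_into (span S) T v"
    have x: "x \<in> span S" "T x = v"
      using v bij unfolding x_def bij_betw_def by (auto intro: inv_into_into f_inv_into_f)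
    have "(norm x)\<^sup>2 \<le> L\<^sup>2 * B x x" by (rule lower[OF x(1)])
    also have "\<dots> = (L * L2_set v {1..k})\<^sup>2"
      using LT[OF x(1)] x(2) psd by (simp add: power_mult_distrib)
    also have "\<dots> \<le> (L * 1)\<^sup>2"
      using v \<open>L \<ge> 0\<close> by (intro power_mono mult_left_mono mult_nonneg_nonneg) auto
    finally show "norm (inv_into (span S) T v) \<le> L"
      using \<open>L \<ge> 0\<close> by (simp flip: x_def)
  qed
  \<comment> \<open>Needed for every competing isomorphism: only when the products of norms are
    bounded below is their infimum at most the value at \<open>T\<close>. Bessel's inequality bounds
    the coefficients.\<close>
  moreover have nonneg: "0 \<le> iso_norm (span S) k T'" "0 \<le> iso_inv_norm (span S) k T'"
    if T': "ell2_iso (span S) k T'" for T'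
  proof -
    have "\<bar>B (f i) x\<bar> \<le> M * norm x" if i: "i \<in> {1..k}" for i x
    proof -
      have "(B (f i) x)\<^sup>2 \<le> (\<Sum>i=1..k. (B (f i) x)\<^sup>2)"
        using i by (intro member_le_sum) auto
      also have "\<dots> \<le> B x x" by (rule bessel)
      finally have "\<bar>B (f i) x\<bar> \<le> sqrt (B x x)" by (simp add: real_le_rsqrt)
      also have "\<dots> \<le> M * norm x" by (rule Bsqrt)
      finally show ?thesis .
    qed
    moreover have "x = (\<Sum>i=1..k. B (f i) x *\<^sub>R f i)" if "x \<in> span S" for x
      using Pid[OF that] by (simp add: P_def)
    ultimately show "0 \<le> iso_norm (span S) k T'" "0 \<le> iso_inv_norm (span S) k T'"
      using ell2_iso_norms_nonneg[OF T' subspace_span, of "{1..k}" f "\<lambda>i. B (f i)" M] fS by auto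
  qed
  ultimately have "iso_norm (span S) k T * iso_inv_norm (span S) k T \<le> M * L"
    using iso \<open>M \<ge> 0\<close> by (intro mult_mono) auto
  moreover have "bm_dist_ell2 (span S) \<le> iso_norm (span S) k T * iso_inv_norm (span S) k T"
    unfolding bm_dist_ell2_def dim
  proof (rule cINF_lower)
    show "bdd_below ((\<lambda>T. iso_norm (span S) k T * iso_inv_norm (span S) k T) ` {T. ell2_iso (span S) k T})"
      by (rule bdd_belowI2[where m = 0]) (use nonneg in auto)
  qed (use iso in auto)
  ultimately have "bm_dist_ell2 (span S) \<le> L * M" by (simp add: mult.commute)
  moreover have "onorm P \<le> L * M" using normP \<open>M \<ge> 0\<close> \<open>L \<ge> 0\<close> by (intro onorm_bound) auto
  ultimately show thesis using proj that by blast
qed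

section \<open>Well-conditioned vectors\<close>

text \<open>Each functional costs at most one dimension, because a basis of its kernel together with
  one vector off the kernel spans the whole. It is applied to the first \<open>n\<close> coordinate
  functionals.\<close>

lemma independent_common_kernel:
  fixes f :: "nat \<Rightarrow> 'a::real_vector \<Rightarrow> real"
  assumes "\<And>i. linear (f i)" "finite S" "independent S"
  shows "\<exists>T. finite T \<and> independent T \<and> T \<subseteq> span S \<and> card S \<le> card T + n
    \<and> (\<forall>i<n. \<forall>x\<in>T. f i x = 0)"
proof (induction n)
  case 0
  then show ?case using assms by (auto intro: span_base)
next
  case (Suc n)
  then obtain T where T: "finite T" "independent T" "T \<subseteq> span S" "card S \<le> card T + n"
    "\<forall>i<n. \<forall>x\<in>T. f i x = 0" by blast
  have spanT: "span T \<subseteq> span S" using T(3) by (simp add: span_minimal)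
  have ker: "f i x = 0" if "x \<in> span T" "i < n" for i x
    using that(1) T(5) that(2) linear_eq_0_on_span[OF assms(1)[of i], of T] by blast
  show ?case
  proof (cases "\<exists>b\<in>T. f n b \<noteq> 0")
    case False
    with T show ?thesis by (intro exI[of _ T]) (auto simp: less_Suc_eq)
  next
    case True
    then obtain b where b: "b \<in> T" "f n b \<noteq> 0" by blast
    obtain U where U: "U \<subseteq> {x \<in> span T. f n x = 0}" "independent U"
        "{x \<in> span T. f n x = 0} \<subseteq> span U"
      using maximal_independent_subset by blast
    have finU: "finite U" using independent_span_bound[OF T(1) U(2)] U(1) by blast
    have "T \<subseteq> span (insert b U)"
    proof
      fix x assume x: "x \<in> T"
      \<comment> \<open>The multiple of \<open>b\<close> is chosen to put \<open>y\<close> into the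
        kernel of \<open>f n\<close>.\<close>
      define y where "y = x - (f n x / f n b) *\<^sub>R b"
      have "f n y = 0" using b assms(1) by (simp add: y_def linear_diff linear_cmul)
      moreover have "y \<in> span T" unfolding y_def using x b by (intro span_diff span_scale span_base)
      ultimately have "y \<in> span (insert b U)" using U(3) span_mono[of U "insert b U"] by blast
      then have "y + (f n x / f n b) *\<^sub>R b \<in> span (insert b U)"
        by (blast intro: span_add span_scale span_base)
      then show "x \<in> span (insert b U)" by (simp add: y_def)
    qed
    then have "card T \<le> card (insert b U)"
      using independent_span_bound[of "insert b U" T] finU T by auto
    also have "\<dots> \<le> card U + 1" using finU by (simp add: card_insert_if)
    finally have "card S \<le> card U + Suc n" using T by simp
    moreover have "U \<subseteq> span S" using U(1) spanT by auto
    moreover have "f i x = 0" if "i < Suc n" "x \<in> U" for i x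
      using that U(1) ker by (auto simp: less_Suc_eq)
    ultimately show ?thesis using finU U(2) by blast
  qed
qed

section \<open>Linear combinations with controlled coefficients\<close>

lemma span_image_lessThan:
  fixes x :: "nat \<Rightarrow> 'a::real_vector"
  shows "span (x ` {..<n}) = range (\<lambda>a. \<Sum>i<n. a i *\<^sub>R x i)" (is "_ = range ?v")
proof (rule antisym)
  have v_comb: "?v (\<lambda>i. s * a i + t * b i) = s *\<^sub>R ?v a + t *\<^sub>R ?v b" for s t a b
    by (simp add: scaleR_add_left sum.distrib scaleR_right.sum)
  have "subspace (range ?v)"
    unfolding subspace_def
  proof (intro conjI ballI allI)
    show "0 \<in> range ?v" by (rule range_eqI[of _ _ "\<lambda>_. 0"]) simp
    fix y assume "y \<in> range ?v"
    then obtain a where a: "y = ?v a" by blast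
    show "c *\<^sub>R y \<in> range ?v" for c
      using v_comb[of c a 0 a] unfolding a by (intro range_eqI[of _ _ "\<lambda>i. c * a i + 0 * a i"]) simp
    fix z assume "z \<in> range ?v"
    then obtain b where b: "z = ?v b" by blast
    show "y + z \<in> range ?v"
      using v_comb[of 1 a 1 b] unfolding a b by (intro range_eqI[of _ _ "\<lambda>i. 1 * a i + 1 * b i"]) simp
  qed
  moreover have "x i \<in> range ?v" if "i < n" for i
  proof -
    have "?v (\<lambda>k. if k = i then 1 else 0) = (\<Sum>k<n. if k = i then x i else 0)"
      by (intro sum.cong) auto
    with that show ?thesis by (intro range_eqI[of _ _ "\<lambda>k. if k = i then 1 else 0"]) simp
  qed
  ultimately show "span (x ` {..<n}) \<subseteq> range ?v" by (intro span_minimal) auto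
  show "range ?v \<subseteq> span (x ` {..<n})" by (force intro: span_sum span_scale span_base)
qed

text \<open>The bound makes null combinations trivial. Applied to the difference of two unit
  coefficient sequences, this also excludes coincidences among the \<open>x i\<close>.\<close>

lemma dim_span_bounded_coefficients:
  fixes x :: "nat \<Rightarrow> 'a::real_normed_vector"
  assumes bound: "\<And>a. (\<Sum>i<n. \<bar>a i\<bar>) \<le> K * norm (\<Sum>i<n. a i *\<^sub>R x i)"
  shows "dim (span (x ` {..<n})) = n"
proof -
  have zero: "a i = 0" if "(\<Sum>i<n. a i *\<^sub>R x i) = 0" "i < n" for a i
  proof -
    have "\<bar>a i\<bar> \<le> (\<Sum>i<n. \<bar>a i\<bar>)" using that by (intro member_le_sum) auto
    with bound[of a] that show ?thesis by simp
  qed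
  have inj: "inj_on x {..<n}"
  proof (rule inj_onI, rule ccontr)
    fix i j assume ij: "i \<in> {..<n}" "j \<in> {..<n}" "x i = x j" "i \<noteq> j"
    have "(\<Sum>k<n. ((if k = i then 1 else 0) - (if k = j then 1 else 0)) *\<^sub>R x k)
        = (\<Sum>k<n. if k = i then x i else 0) - (\<Sum>k<n. if k = j then x j else 0)"
      unfolding sum_subtractf[symmetric] by (intro sum.cong) auto
    also have "\<dots> = 0" using ij by simp
    finally show False using zero[of "\<lambda>k. (if k = i then 1 else 0) - (if k = j then 1 else 0)" i] ij
      by simp
  qed
  have "independent (x ` {..<n})"
  proof (rule independent_if_scalars_zero)
    fix f y assume "(\<Sum>y\<in>x ` {..<n}. f y *\<^sub>R y) = 0" "y \<in> x ` {..<n}"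
    then show "f y = 0" using zero[of "\<lambda>i. f (x i)"] by (auto simp: sum.reindex[OF inj])
  qed simp
  then show ?thesis using dim_eq_card_independent[of "x ` {..<n}"] inj by (simp add: dim_span card_image)
qed

text \<open>The span is closed: by the bound, convergence of the combinations makes each coefficient
  sequence Cauchy, and the limits of the coefficients represent the limit.\<close>

lemma limit_in_range_of_bounded_coefficients:
  fixes x :: "nat \<Rightarrow> 'a::real_normed_vector"
  assumes bound: "\<And>a. (\<Sum>i<n. \<bar>a i\<bar>) \<le> K * norm (\<Sum>i<n. a i *\<^sub>R x i)" and "K > 0"
    and lim: "(\<lambda>m. \<Sum>i<n. a m i *\<^sub>R x i) \<longlonglongrightarrow> b"
  shows "b \<in> range (\<lambda>a. \<Sum>i<n. a i *\<^sub>R x i)"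
proof -
  have "Cauchy (\<lambda>m. a m i)" if i: "i < n" for i
  proof (rule metric_CauchyI)
    fix r :: real assume "r > 0"
    with \<open>K > 0\<close> have "r / K > 0" by simp
    with LIMSEQ_imp_Cauchy[OF lim] obtain M where M: "\<And>m l. m \<ge> M \<Longrightarrow> l \<ge> M \<Longrightarrow>
        dist (\<Sum>i<n. a m i *\<^sub>R x i) (\<Sum>i<n. a l i *\<^sub>R x i) < r / K"
      unfolding Cauchy_def by blast
    show "\<exists>M. \<forall>m\<ge>M. \<forall>l\<ge>M. dist (a m i) (a l i) < r"
    proof (intro exI allI impI)
      fix m l assume ml: "m \<ge> M" "l \<ge> M"
      have "dist (a m i) (a l i) \<le> (\<Sum>i<n. \<bar>a m i - a l i\<bar>)"
        using i by (auto simp: dist_real_def intro!: member_le_sum)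
      also have "\<dots> \<le> K * norm (\<Sum>i<n. (a m i - a l i) *\<^sub>R x i)" by (rule bound)
      also have "(\<Sum>i<n. (a m i - a l i) *\<^sub>R x i) = (\<Sum>i<n. a m i *\<^sub>R x i) - (\<Sum>i<n. a l i *\<^sub>R x i)"
        by (simp add: scaleR_diff_left sum_subtractf)
      also have "K * norm \<dots> < K * (r / K)"
        using M[OF ml] \<open>K > 0\<close> by (intro mult_strict_left_mono) (auto simp: dist_norm)
      finally show "dist (a m i) (a l i) < r" using \<open>K > 0\<close> by simp
    qed
  qed
  then have "\<exists>l. (\<lambda>m. a m i) \<longlonglongrightarrow> l" if "i < n" for i
    using that by (simp add: Cauchy_convergent_iff convergent_def)
  then obtain l where "\<And>i. i < n \<Longrightarrow> (\<lambda>m. a m i) \<longlonglongrightarrow> l i" by metis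
  then have "(\<lambda>m. \<Sum>i<n. a m i *\<^sub>R x i) \<longlonglongrightarrow> (\<Sum>i<n. l i *\<^sub>R x i)"
    by (intro tendsto_sum tendsto_scaleR tendsto_const) auto
  with lim have "b = (\<Sum>i<n. l i *\<^sub>R x i)" by (rule LIMSEQ_unique)
  then show ?thesis by blast
qed

text \<open>Riesz's lemma, applied repeatedly, gives independent unit vectors whose coordinate
  functionals are bounded in terms of their number alone.\<close>

lemma well_conditioned_vectors:
  fixes S :: "'a::real_normed_vector set"
  assumes "finite S" "independent S" "n \<le> card S"
  shows "\<exists>x::nat \<Rightarrow> 'a. (\<forall>i<n. x i \<in> span S \<and> norm (x i) \<le> 1)
    \<and> (\<forall>a. (\<Sum>i<n. \<bar>a i\<bar>) \<le> 5 ^ n * norm (\<Sum>i<n. a i *\<^sub>R x i))"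
  using assms(3)
proof (induction n)
  case 0
  then show ?case by auto
next
  case (Suc n)
  then obtain x :: "nat \<Rightarrow> 'a" where x: "\<And>i. i < n \<Longrightarrow> x i \<in> span S \<and> norm (x i) \<le> 1"
    and bound: "\<And>a. (\<Sum>i<n. \<bar>a i\<bar>) \<le> 5 ^ n * norm (\<Sum>i<n. a i *\<^sub>R x i)" by auto
  define v where "v = (\<lambda>a. \<Sum>i<n. a i *\<^sub>R x i)"
  have v_comb: "v (\<lambda>i. s * a i + t * b i) = s *\<^sub>R v a + t *\<^sub>R v b" for s t a b
    by (simp add: v_def scaleR_add_left sum.distrib scaleR_right.sum)
  \<comment> \<open>More than \<open>n\<close> independent vectors do not fit into the span of
    \<open>n\<close> vectors; this supplies a vector \<open>b\<close> outside it.\<close>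
  have "\<not> S \<subseteq> range v"
  proof
    assume "S \<subseteq> range v"
    also have "range v \<subseteq> span (x ` {..<n})"
      by (simp add: span_image_lessThan v_def)
    finally have "card S \<le> card (x ` {..<n})"
      using independent_span_bound[of "x ` {..<n}" S] assms by simp
    also have "\<dots> \<le> n" using card_image_le[of "{..<n}" x] by simp
    finally show False using Suc.prems by simp
  qed
  then obtain b where b: "b \<in> S" "b \<notin> range v" by blast
  define d where "d = (INF a. norm (b - v a))"
  have bdd: "bdd_below (range (\<lambda>a. norm (b - v a)))" by (rule bdd_belowI2[where m = 0]) auto
  have d_le: "d \<le> norm (b - v a)" for a unfolding d_def by (rule cINF_lower[OF bdd]) auto
  \<comment> \<open>The distance from \<open>b\<close> to a closed subspace not containing
    it.\<close>
  have "d > 0"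
  proof (rule ccontr)
    assume "\<not> d > 0"
    then have "d < inverse (real (Suc m))" for m
      by (smt (verit) inverse_positive_iff_positive of_nat_0_less_iff zero_less_Suc)
    then have "\<exists>a. norm (b - v a) < inverse (real (Suc m))" for m
      using cInf_lessD[of "range (\<lambda>a. norm (b - v a))" "inverse (real (Suc m))"]
      by (auto simp: d_def)
    then obtain a where a: "\<And>m. norm (b - v (a m)) < inverse (real (Suc m))" by metis
    have "(\<lambda>m. b - v (a m)) \<longlonglongrightarrow> 0"
      by (rule tendsto_0_le[OF LIMSEQ_inverse_real_of_nat, of _ 1])
        (use a in \<open>auto intro!: always_eventually less_imp_le\<close>)
    then have "(\<lambda>m. b - (b - v (a m))) \<longlonglongrightarrow> b - 0" by (intro tendsto_diff tendsto_const)
    then have "(\<lambda>m. \<Sum>i<n. a m i *\<^sub>R x i) \<longlonglongrightarrow> b" by (simp add: v_def)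
    from limit_in_range_of_bounded_coefficients[OF bound _ this] b show False by (simp add: v_def)
  qed
  then have "d < 2 * d" by simp
  \<comment> \<open>The distance need not be attained here; being within a factor 2 of it
    suffices.\<close>
  then obtain a0 where a0: "norm (b - v a0) < 2 * d"
    using cInf_lessD[of "range (\<lambda>a. norm (b - v a))" "2 * d"] by (auto simp: d_def)
  define r where "r = b - v a0"
  have r: "norm r > 0" "norm r < 2 * d" using d_le[of a0] \<open>d > 0\<close> a0 by (auto simp: r_def)
  define y where "y = (1 / norm r) *\<^sub>R r"
  have "v a0 \<in> span S" unfolding v_def using x by (intro span_sum span_scale) auto
  then have "b - v a0 \<in> span S" using b by (blast intro: span_diff span_base)
  then have y: "y \<in> span S" "norm y \<le> 1" using r by (auto simp: y_def r_def intro: span_scale)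
  \<comment> \<open>Up to the factor \<open>t / norm r\<close>, the vector
    \<open>v a + t *\<^sub>R y\<close> is \<open>b\<close> minus an element of the span, hence has
    norm at least \<open>d > norm r / 2\<close> times that factor in absolute value.\<close>
  have far: "\<bar>t\<bar> \<le> 2 * norm (v a + t *\<^sub>R y)" for a t
  proof (cases "t = 0")
    case False
    define c where "c = (\<lambda>i. 1 * a0 i + (- (norm r / t)) * a i)"
    have "v c = v a0 - (norm r / t) *\<^sub>R v a"
      unfolding c_def by (subst v_comb) simp
    then have "b - v c = r + (norm r / t) *\<^sub>R v a" by (simp add: r_def)
    then have "(t / norm r) *\<^sub>R (b - v c) = v a + t *\<^sub>R y"
      using False r by (simp add: y_def scaleR_add_right)
    then have "norm (v a + t *\<^sub>R y) = \<bar>t\<bar> / norm r * norm (b - v c)"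
      by (metis abs_divide abs_norm_cancel norm_scaleR)
    also have "\<dots> \<ge> \<bar>t\<bar> / norm r * d" by (intro mult_left_mono d_le) auto
    finally have "\<bar>t\<bar> / norm r * d \<le> norm (v a + t *\<^sub>R y)" .
    moreover have "\<bar>t\<bar> / 2 \<le> \<bar>t\<bar> / norm r * d"
    proof -
      have "\<bar>t\<bar> * norm r \<le> \<bar>t\<bar> * (2 * d)" using r by (intro mult_left_mono) auto
      then show ?thesis using r by (simp add: field_simps)
    qed
    ultimately show ?thesis by linarith
  qed simp
  \<comment> \<open>The base 5 arises as 3 + 2: the last coefficient is at most
    \<open>2 * norm ?z\<close>, hence the remaining part of the vector has norm at most
    \<open>3 * norm ?z\<close>.\<close>
  have "(\<Sum>i<Suc n. \<bar>a i\<bar>) \<le> 5 ^ Suc n * norm (v a + a n *\<^sub>R y)" for a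
  proof -
    let ?z = "v a + a n *\<^sub>R y"
    have "norm (v a) \<le> norm ?z + norm (a n *\<^sub>R y)"
      using norm_triangle_ineq4[of ?z "a n *\<^sub>R y"] by simp
    also have "norm (a n *\<^sub>R y) \<le> \<bar>a n\<bar>" using y by (simp add: mult_left_le)
    finally have "norm (v a) \<le> 3 * norm ?z" using far[of "a n" a] by simp
    then have "(\<Sum>i<n. \<bar>a i\<bar>) \<le> 5 ^ n * (3 * norm ?z)"
      using bound[of a] by (simp add: v_def order.trans[OF _ mult_left_mono])
    moreover have "2 * norm ?z \<le> 5 ^ n * (2 * norm ?z)"
      by (simp add: mult_le_cancel_right1)
    ultimately show ?thesis using far[of "a n" a] by simp
  qed
  moreover have "(\<Sum>i<Suc n. a i *\<^sub>R (x(n := y)) i) = v a + a n *\<^sub>R y" for a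
    by (simp add: v_def)
  ultimately show ?case using x y
    by (intro exI[of _ "x(n := y)"]) (auto simp: less_Suc_eq)
qed

section \<open>Splitting the norm over disjoint sets\<close>

lemma lp_norm_2: "lp_norm 2 n a = L2_set a {1..n}"
proof -
  have "\<bar>a i\<bar> powr 2 = (a i)\<^sup>2" for i by (cases "a i = 0") (auto simp: powr_numeral)
  then show ?thesis by (simp add: lp_norm_def L2_set_def powr_half_sqrt sum_nonneg)
qed

lemma lp_equivalent_mono: "lp_equivalent C p n x \<Longrightarrow> C \<le> D \<Longrightarrow> lp_equivalent D p n x"
  unfolding lp_equivalent_def by (meson order_trans)

text \<open>The threshold \<open>n\<close> is also a budget: up to \<open>n\<close> such sets have
  their minima in the Schreier family.\<close>

definition sets_beyond :: "nat \<Rightarrow> nat set set \<Rightarrow> bool" where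
  "sets_beyond n \<S> \<longleftrightarrow> finite \<S> \<and> disjoint \<S> \<and> (\<forall>S\<in>\<S>. finite S \<and> S \<noteq> {} \<and> S \<subseteq> {n..})"

lemma sets_beyond_subset: "sets_beyond n \<S> \<Longrightarrow> \<T> \<subseteq> \<S> \<Longrightarrow> sets_beyond n \<T>"
  unfolding sets_beyond_def by (meson finite_subset pairwise_subset subsetD)

lemma sets_beyond_Min: "sets_beyond n \<S> \<Longrightarrow> S \<in> \<S> \<Longrightarrow> Min S \<in> S \<and> n \<le> Min S"
  unfolding sets_beyond_def by (metis Min_in atLeast_iff subsetD)

lemma sets_beyond_raise:
  "sets_beyond n \<S> \<Longrightarrow> (\<And>S. S \<in> \<S> \<Longrightarrow> m \<le> Min S) \<Longrightarrow> sets_beyond m \<S>"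
  unfolding sets_beyond_def by (meson Min_le atLeast_iff order_trans subsetI)

text \<open>Disjoint sets have distinct minima, so the minima count the sets.\<close>

lemma sets_beyond_card_le:
  assumes "sets_beyond n \<S>" "\<And>S. S \<in> \<S> \<Longrightarrow> Min S < b"
  shows "card \<S> \<le> b - n"
proof -
  have "inj_on Min \<S>"
  proof (rule inj_onI)
    fix S T assume ST: "S \<in> \<S>" "T \<in> \<S>" "Min S = Min T"
    then have "\<not> disjnt S T" using sets_beyond_Min[OF assms(1)] by (metis disjnt_iff)
    then show "S = T" using ST assms(1) by (auto simp: sets_beyond_def pairwise_def)
  qed
  then have "card \<S> = card (Min ` \<S>)" by (simp add: card_image)
  also have "\<dots> \<le> card {n..<b}"
    using assms sets_beyond_Min[OF assms(1)] by (intro card_mono) auto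
  finally show ?thesis by simp
qed

section \<open>Families of sets that split the norm\<close>

locale asymptotic_ell2 =
  fixes e :: "nat \<Rightarrow> 'a::banach" and C :: real
  assumes C: "C \<ge> 1"
    and equivalent: "\<And>n x. (\<forall>i\<in>{1..n}. x i \<in> c00 \<and> norm (basis_vec e (x i)) = 1) \<Longrightarrow>
      S1_allowable n (\<lambda>i. supp (x i)) \<Longrightarrow> lp_equivalent C 2 n (\<lambda>i. basis_vec e (x i))"
begin

definition vec :: "(nat \<Rightarrow> real) \<Rightarrow> nat set \<Rightarrow> 'a" where
  "vec y S = (\<Sum>j\<in>S. y j *\<^sub>R e j)"

text \<open>A property of the sets alone, uniform over all coefficients \<open>y\<close>. In this
  squared, two-sided form, regrouping multiplies the constants.\<close>

definition splits :: "real \<Rightarrow> nat set set \<Rightarrow> bool" where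
  "splits K \<S> \<longleftrightarrow> (\<forall>y. (\<Sum>S\<in>\<S>. (norm (vec y S))\<^sup>2) \<le> K\<^sup>2 * (norm (vec y (\<Union>\<S>)))\<^sup>2 \<and>
     (norm (vec y (\<Union>\<S>)))\<^sup>2 \<le> K\<^sup>2 * (\<Sum>S\<in>\<S>. (norm (vec y S))\<^sup>2))"

lemma vec_Union: "sets_beyond n \<S> \<Longrightarrow> vec y (\<Union>\<S>) = (\<Sum>S\<in>\<S>. vec y S)"
  unfolding vec_def sets_beyond_def
  by (subst sum.Union_disjoint) (auto simp: pairwise_def disjnt_def)

text \<open>The asymptotic condition, applied to the normalized blocks with the block norms as
  coefficients.\<close>

lemma splits_base:
  assumes S: "sets_beyond n \<S>" and "n \<ge> 1" and card: "card \<S> \<le> n"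
  shows "splits C \<S>"
  unfolding splits_def
proof
  fix y
  \<comment> \<open>Blocks on which \<open>y\<close> gives the zero vector cannot be normalized;
    they contribute nothing to either side.\<close>
  define \<T> where "\<T> = {S \<in> \<S>. vec y S \<noteq> 0}"
  have finS: "finite \<S>" using S by (simp add: sets_beyond_def)
  have T: "sets_beyond n \<T>" "finite \<T>" "card \<T> \<le> n"
    using sets_beyond_subset[OF S, of \<T>] card card_mono[OF finS, of \<T>] finS by (auto simp: \<T>_def)
  have vec_T: "vec y (\<Union>\<S>) = (\<Sum>S\<in>\<T>. vec y S)"
    unfolding vec_Union[OF S] \<T>_def by (rule sum.mono_neutral_right) (use finS in auto)
  have sum_T: "(\<Sum>S\<in>\<S>. (norm (vec y S))\<^sup>2) = (\<Sum>S\<in>\<T>. (norm (vec y S))\<^sup>2)"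
    unfolding \<T>_def by (rule sum.mono_neutral_right) (use finS in auto)
  define q where "q = card \<T>"
  obtain h where h: "bij_betw h {1..q} \<T>"
    using ex_bij_betw_nat_finite_1[OF T(2)] by (auto simp: q_def)
  have hT: "h i \<in> \<T>" if "i \<in> {1..q}" for i using h that by (auto simp: bij_betw_def)
  have hi: "finite (h i)" "h i \<subseteq> {n..}" "vec y (h i) \<noteq> 0" if "i \<in> {1..q}" for i
    using hT[OF that] T(1) by (auto simp: \<T>_def sets_beyond_def)
  define x where "x = (\<lambda>i j. if j \<in> h i then y j / norm (vec y (h i)) else 0)"
  have supp_x: "supp (x i) \<subseteq> h i" for i by (auto simp: supp_def x_def)
  have bv: "basis_vec e (x i) = (1 / norm (vec y (h i))) *\<^sub>R vec y (h i)" if i: "i \<in> {1..q}" for i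
  proof -
    have "basis_vec e (x i) = (\<Sum>j\<in>h i. x i j *\<^sub>R e j)"
      unfolding basis_vec_def
      by (rule sum.mono_neutral_left) (use hi[OF i] supp_x in \<open>auto simp: supp_def\<close>)
    then show ?thesis by (simp add: x_def vec_def scaleR_right.sum)
  qed
  have norm1: "norm (basis_vec e (x i)) = 1" if "i \<in> {1..q}" for i
    using bv[OF that] hi[OF that] by simp
  have "x i \<in> c00" if "i \<in> {1..q}" for i
    using hi[OF that] finite_subset[OF supp_x, of i] \<open>n \<ge> 1\<close> by (force simp: c00_def x_def)
  moreover have "S1_allowable q (\<lambda>i. supp (x i))"
    unfolding S1_allowable_def
  proof (intro conjI ballI)
    have supp: "finite (supp (x i)) \<and> supp (x i) \<noteq> {} \<and> supp (x i) \<subseteq> {n..}" if "i \<in> {1..q}" for i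
      using finite_subset[OF supp_x hi(1)[OF that]] supp_x[of i] hi[OF that] norm1[OF that]
      by (auto simp: basis_vec_def)
    then have Min: "n \<le> Min (supp (x i))" if "i \<in> {1..q}" for i
      using that by (metis Min_in atLeast_iff subsetD)
    show "finite (supp (x i))" "supp (x i) \<noteq> {}" "supp (x i) \<subseteq> {1..}" if "i \<in> {1..q}" for i
      using supp[OF that] \<open>n \<ge> 1\<close> by auto
    show "disjoint_family_on (\<lambda>i. supp (x i)) {1..q}"
      unfolding disjoint_family_on_def
    proof (intro ballI impI)
      fix i j assume ij: "i \<in> {1..q}" "j \<in> {1..q}" "i \<noteq> j"
      then have "h i \<noteq> h j" using h by (metis bij_betw_def inj_on_def)
      then have "disjnt (h i) (h j)"
        using hT ij T(1) by (auto simp: sets_beyond_def pairwise_def)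
      then show "supp (x i) \<inter> supp (x j) = {}" using supp_x[of i] supp_x[of j] by (auto simp: disjnt_def)
    qed
    \<comment> \<open>At most \<open>n\<close> minima, each at least \<open>n\<close>: this is the
      Schreier condition.\<close>
    let ?F = "(\<lambda>i. Min (supp (x i))) ` {1..q}"
    have "card ?F \<le> n" using card_image_le[of "{1..q}" "\<lambda>i. Min (supp (x i))"] T(3) by (simp add: q_def)
    moreover have "n \<le> Min ?F" if "?F \<noteq> {}"
      using Min_in[of ?F] that Min by (metis (no_types, lifting) finite_atLeastAtMost finite_imageI imageE)
    ultimately show "?F \<in> schreier1"
      using Min \<open>n \<ge> 1\<close> unfolding schreier1_def by fastforce
  qed
  ultimately have "lp_equivalent C 2 q (\<lambda>i. basis_vec e (x i))"
    using norm1 equivalent by blast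
  then obtain A B where AB: "A > 0" "B > 0" "A * B \<le> C"
    and low: "\<And>a. 1 / A * L2_set a {1..q} \<le> norm (\<Sum>i=1..q. a i *\<^sub>R basis_vec e (x i))"
    and up: "\<And>a. norm (\<Sum>i=1..q. a i *\<^sub>R basis_vec e (x i)) \<le> B * L2_set a {1..q}"
    unfolding lp_equivalent_def lp_norm_2 by blast
  define l where "l = L2_set (\<lambda>i. norm (vec y (h i))) {1..q}"
  have "(\<Sum>i=1..q. norm (vec y (h i)) *\<^sub>R basis_vec e (x i)) = (\<Sum>i=1..q. vec y (h i))"
    using bv hi by (intro sum.cong) auto
  also have "\<dots> = vec y (\<Union>\<S>)" unfolding vec_T by (rule sum.reindex_bij_betw[OF h])
  finally have main: "1 / A * l \<le> norm (vec y (\<Union>\<S>))" "norm (vec y (\<Union>\<S>)) \<le> B * l"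
    using low[of "\<lambda>i. norm (vec y (h i))"] up[of "\<lambda>i. norm (vec y (h i))"] by (auto simp: l_def)
  have l: "l\<^sup>2 = (\<Sum>S\<in>\<S>. (norm (vec y S))\<^sup>2)" "l \<ge> 0"
    unfolding sum_T sum.reindex_bij_betw[OF h, symmetric] by (simp_all add: l_def L2_set_def sum_nonneg)
  have "l \<le> C * norm (vec y (\<Union>\<S>)) \<and> norm (vec y (\<Union>\<S>)) \<le> C * l"
  proof (cases "q = 0")
    case True
    then show ?thesis using main C by (simp add: l_def)
  next
    case False
    \<comment> \<open>Testing on one norm-one vector gives \<open>A \<ge> 1\<close> and
      \<open>B \<ge> 1\<close>, so that \<open>A * B \<le> C\<close> bounds each factor by
      \<open>C\<close>.\<close>
    define a where "a = (\<lambda>i::nat. if i = 1 then 1 else 0 :: real)"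
    have "(\<Sum>i=1..q. a i *\<^sub>R basis_vec e (x i)) = (\<Sum>i=1..q. if i = 1 then basis_vec e (x 1) else 0)"
      by (intro sum.cong) (auto simp: a_def)
    then have "norm (\<Sum>i=1..q. a i *\<^sub>R basis_vec e (x i)) = 1"
      using False norm1[of 1] by simp
    moreover have "L2_set a {1..q} = 1"
    proof -
      have "(\<Sum>i=1..q. (a i)\<^sup>2) = (\<Sum>i=1..q. if i = 1 then 1 else 0)"
        by (intro sum.cong) (auto simp: a_def)
      then show ?thesis using False by (simp add: L2_set_def)
    qed
    ultimately have "1 \<le> A" "1 \<le> B" using low[of a] up[of a] AB by auto
    then have "A \<le> C" "B \<le> C"
      using AB by (smt (verit) mult_le_cancel_left1 mult_le_cancel_right1)+
    have "l \<le> A * norm (vec y (\<Union>\<S>))" using main(1) AB(1) by (simp add: field_simps)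
    also have "\<dots> \<le> C * norm (vec y (\<Union>\<S>))" using \<open>A \<le> C\<close> by (rule mult_right_mono) simp
    finally have "l \<le> C * norm (vec y (\<Union>\<S>))" .
    moreover have "B * l \<le> C * l" using \<open>B \<le> C\<close> l(2) by (rule mult_right_mono)
    ultimately show ?thesis using main(2) by simp
  qed
  then have "l\<^sup>2 \<le> (C * norm (vec y (\<Union>\<S>)))\<^sup>2 \<and> (norm (vec y (\<Union>\<S>)))\<^sup>2 \<le> (C * l)\<^sup>2"
    using l(2) by (intro conjI power_mono) auto
  then show "(\<Sum>S\<in>\<S>. (norm (vec y S))\<^sup>2) \<le> C\<^sup>2 * (norm (vec y (\<Union>\<S>)))\<^sup>2 \<and>
     (norm (vec y (\<Union>\<S>)))\<^sup>2 \<le> C\<^sup>2 * (\<Sum>S\<in>\<S>. (norm (vec y S))\<^sup>2)"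
    by (simp add: power_mult_distrib l)
qed

text \<open>Two levels of splitting: the unions of the groups are few enough for
  \<open>splits_base\<close>, which costs \<open>C\<close>, and each group splits with
  \<open>K\<close>.\<close>

lemma splits_group:
  assumes S: "sets_beyond n \<S>" and "n \<ge> 1" and card: "card (f ` \<S>) \<le> n"
    and parts: "\<And>t. t \<in> f ` \<S> \<Longrightarrow> splits K {S \<in> \<S>. f S = t}"
  shows "splits (C * K) \<S>"
proof -
  define U where "U = (\<lambda>t. \<Union>{S \<in> \<S>. f S = t})"
  have finS: "finite \<S>" using S by (simp add: sets_beyond_def)
  have dis: "disjnt (U s) (U t)" if "s \<noteq> t" for s t
  proof -
    have "disjnt A B" if "A \<in> \<S>" "B \<in> \<S>" "f A = s" "f B = t" for A B
      using S that \<open>s \<noteq> t\<close> by (auto simp: sets_beyond_def pairwise_def)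
    then show ?thesis by (force simp: U_def disjnt_iff)
  qed
  have ne: "U t \<noteq> {}" if "t \<in> f ` \<S>" for t
    using that S by (fastforce simp: U_def sets_beyond_def)
  \<comment> \<open>The unions are disjoint and nonempty, so a sum over the unions is a sum over the
    labels.\<close>
  have inj: "inj_on U (f ` \<S>)"
    by (rule inj_onI) (metis dis ne disjnt_self_iff_empty)
  have beyond: "sets_beyond n (U ` f ` \<S>)"
    unfolding sets_beyond_def
  proof (intro conjI ballI)
    show "disjoint (U ` f ` \<S>)" using dis by (intro pairwiseI) (metis imageE)
    fix A assume "A \<in> U ` f ` \<S>"
    with S ne show "finite A" "A \<noteq> {}" "A \<subseteq> {n..}"
      by (auto simp: U_def sets_beyond_def)
  qed (use finS in auto)
  have base: "splits C (U ` f ` \<S>)"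
    using card card_image_le[of "f ` \<S>" U] finS by (intro splits_base[OF beyond \<open>n \<ge> 1\<close>]) simp
  have Un: "\<Union>(U ` f ` \<S>) = \<Union>\<S>" by (auto simp: U_def)
  show ?thesis
    unfolding splits_def
  proof (intro allI conjI)
    fix y
    have reindex: "(\<Sum>A\<in>U ` f ` \<S>. (norm (vec y A))\<^sup>2) = (\<Sum>t\<in>f ` \<S>. (norm (vec y (U t)))\<^sup>2)"
      by (simp add: sum.reindex[OF inj])
    have group: "(\<Sum>S\<in>\<S>. (norm (vec y S))\<^sup>2) = (\<Sum>t\<in>f ` \<S>. \<Sum>S\<in>{S \<in> \<S>. f S = t}. (norm (vec y S))\<^sup>2)"
      by (rule sum.image_gen[OF finS])
    have "(\<Sum>S\<in>\<S>. (norm (vec y S))\<^sup>2) \<le> (\<Sum>t\<in>f ` \<S>. K\<^sup>2 * (norm (vec y (U t)))\<^sup>2)"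
      unfolding group using parts by (intro sum_mono) (auto simp: splits_def U_def)
    also have "\<dots> = K\<^sup>2 * (\<Sum>A\<in>U ` f ` \<S>. (norm (vec y A))\<^sup>2)"
      by (simp add: reindex sum_distrib_left)
    also have "\<dots> \<le> K\<^sup>2 * (C\<^sup>2 * (norm (vec y (\<Union>\<S>)))\<^sup>2)"
      using base unfolding splits_def Un by (intro mult_left_mono) auto
    finally show "(\<Sum>S\<in>\<S>. (norm (vec y S))\<^sup>2) \<le> (C * K)\<^sup>2 * (norm (vec y (\<Union>\<S>)))\<^sup>2"
      by (simp add: power_mult_distrib mult_ac)
    have "(norm (vec y (\<Union>\<S>)))\<^sup>2 \<le> C\<^sup>2 * (\<Sum>A\<in>U ` f ` \<S>. (norm (vec y A))\<^sup>2)"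
      using base unfolding splits_def Un by blast
    also note reindex
    also have "C\<^sup>2 * (\<Sum>t\<in>f ` \<S>. (norm (vec y (U t)))\<^sup>2)
        \<le> C\<^sup>2 * (\<Sum>t\<in>f ` \<S>. K\<^sup>2 * (\<Sum>S\<in>{S \<in> \<S>. f S = t}. (norm (vec y S))\<^sup>2))"
      using parts by (intro mult_left_mono sum_mono) (auto simp: splits_def U_def)
    also have "\<dots> = (C * K)\<^sup>2 * (\<Sum>S\<in>\<S>. (norm (vec y S))\<^sup>2)"
      unfolding group by (simp add: power_mult_distrib sum_distrib_left mult_ac)
    finally show "(norm (vec y (\<Union>\<S>)))\<^sup>2 \<le> (C * K)\<^sup>2 * (\<Sum>S\<in>\<S>. (norm (vec y S))\<^sup>2)" .
  qed
qed

text \<open>The minima of disjoint sets are distinct, so at most \<open>n 2\<^sup>t\<close> of the sets have their minimum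
  between \<open>n 2\<^sup>t\<close> and \<open>n 2\<^sup>t\<^sup>+\<^sup>1\<close>: these form an allowable family, and so do the unions over \<open>t < n\<close>.\<close>

lemma splits_exponential:
  assumes S: "sets_beyond n \<S>" and n: "n \<ge> 1" and card: "card \<S> \<le> n * 2 ^ (n - 1)"
  shows "splits (C * C) \<S>"
proof -
  have "\<exists>t. n * 2 ^ t \<le> Min S \<and> Min S < n * 2 ^ Suc t" if "S \<in> \<S>" for S
  proof -
    have "1 \<le> Min S div n"
      using sets_beyond_Min[OF S that] n by (simp add: Suc_leI div_greater_zero_iff)
    then obtain t where "2 ^ t \<le> Min S div n" "Min S div n < 2 ^ (t + 1)"
      using ex_power_ivl1[of 2 "Min S div n"] by auto
    then show ?thesis using n
      by (intro exI[of _ t]) (simp add: less_eq_div_iff_mult_less_eq div_less_iff_less_mult mult.commute)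
  qed
  then obtain t where t: "\<And>S. S \<in> \<S> \<Longrightarrow> n * 2 ^ t S \<le> Min S \<and> Min S < n * 2 ^ Suc (t S)"
    by metis
  show ?thesis
  proof (rule splits_group[OF S n, of "\<lambda>S. min (n - 1) (t S)"])
    \<comment> \<open>The \<open>min\<close> merges all blocks from \<open>n - 1\<close> on into
      one, leaving at most \<open>n\<close> groups.\<close>
    have "(\<lambda>S. min (n - 1) (t S)) ` \<S> \<subseteq> {..<n}" using n by auto
    from card_mono[OF _ this] show "card ((\<lambda>S. min (n - 1) (t S)) ` \<S>) \<le> n" by simp
    fix s assume s: "s \<in> (\<lambda>S. min (n - 1) (t S)) ` \<S>"
    let ?G = "{S \<in> \<S>. min (n - 1) (t S) = s}"
    have "n * 2 ^ s \<le> Min S" if "S \<in> ?G" for S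
    proof -
      have "n * 2 ^ s \<le> n * 2 ^ t S" using that by (intro mult_left_mono power_increasing) auto
      then show ?thesis using t[of S] that by (blast intro: order_trans)
    qed
    then have G: "sets_beyond (n * 2 ^ s) ?G"
      by (intro sets_beyond_raise[OF sets_beyond_subset[OF S]]) auto
    \<comment> \<open>For \<open>s < n - 1\<close> the minima lie in one dyadic block, which bounds
      their number. The last group has no upper limit and relies on the assumed bound for
      \<open>card \<S>\<close>.\<close>
    have "card ?G \<le> n * 2 ^ s"
    proof (cases "s = n - 1")
      case True
      have "card ?G \<le> card \<S>" using S by (intro card_mono) (auto simp: sets_beyond_def)
      with card True show ?thesis by simp
    next
      case False
      have "card ?G \<le> n * 2 ^ Suc s - n * 2 ^ s"
        by (rule sets_beyond_card_le[OF G]) (use t False in \<open>force simp: min_def\<close>)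
      then show ?thesis by simp
    qed
    then show "splits C ?G" using n by (intro splits_base[OF G]) auto
  qed
qed

text \<open>Two groups, cut at \<open>m = 2 ^ (n - 1)\<close>. Sets with minimum below
  \<open>m\<close> are few because their minima are distinct; the others lie beyond
  \<open>m\<close>, where the exponential bound allows \<open>m * 2 ^ (m - 1)\<close> sets.\<close>

lemma splits_double_exponential:
  assumes S: "sets_beyond n \<S>" and n: "n \<ge> 2" and card: "card \<S> \<le> 2 ^ (2 ^ (n - 1) - 1)"
  shows "splits (C * (C * C)) \<S>"
proof (rule splits_group[OF S, of "\<lambda>S. Min S < 2 ^ (n - 1)"])
  have "card ((\<lambda>S. Min S < 2 ^ (n - 1)) ` \<S>) \<le> card (UNIV :: bool set)" by (intro card_mono) auto
  then show "card ((\<lambda>S. Min S < 2 ^ (n - 1)) ` \<S>) \<le> n" using n by simp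
  fix b assume b: "b \<in> (\<lambda>S. Min S < 2 ^ (n - 1)) ` \<S>"
  let ?G = "{S \<in> \<S>. (Min S < 2 ^ (n - 1)) = b}"
  have G: "sets_beyond n ?G" by (rule sets_beyond_subset[OF S]) auto
  show "splits (C * C) ?G"
  proof (cases b)
    case True
    have "card ?G \<le> 2 ^ (n - 1) - n" by (rule sets_beyond_card_le[OF G]) (use True in auto)
    also have "\<dots> \<le> n * 2 ^ (n - 1)" using n by (simp add: trans_le_add1 le_diff_conv)
    finally show ?thesis using n by (intro splits_exponential[OF G]) auto
  next
    case False
    then have G': "sets_beyond (2 ^ (n - 1)) ?G" by (intro sets_beyond_raise[OF G]) auto
    have "card ?G \<le> card \<S>" using S by (intro card_mono) (auto simp: sets_beyond_def)
    also have "\<dots> \<le> 1 * 2 ^ (2 ^ (n - 1) - 1)" using card by simp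
    also have "\<dots> \<le> 2 ^ (n - 1) * 2 ^ (2 ^ (n - 1) - 1)" by (intro mult_right_mono) auto
    finally show ?thesis by (intro splits_exponential[OF G']) auto
  qed
qed (use n in auto)

section \<open>Unconditionality beyond the first coordinate\<close>

text \<open>\<open>S\<close> and its complement in \<open>U\<close> form a family of two sets. Such
  a family is allowable when its minima are at least 2, which is why index 1 is excluded here and
  below.\<close>

lemma norm_vec_subset:
  assumes "S \<subseteq> U" "finite U" "U \<subseteq> {2..}"
  shows "norm (vec y S) \<le> C * norm (vec y U)"
proof (cases "S = {} \<or> S = U")
  case True
  then show ?thesis using C by (auto simp: vec_def mult_le_cancel_right1)
next
  case False
  let ?F = "{S, U - S}"
  have F: "sets_beyond 2 ?F"
    using assms False finite_subset[OF assms(1,2)] by (auto simp: sets_beyond_def pairwise_def disjnt_def)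
  have U: "\<Union>?F = U" using assms by auto
  have "S \<noteq> U - S" using False by auto
  then have "(norm (vec y S))\<^sup>2 \<le> (\<Sum>A\<in>?F. (norm (vec y A))\<^sup>2)" by simp
  also have "\<dots> \<le> C\<^sup>2 * (norm (vec y (\<Union>?F)))\<^sup>2"
    using splits_base[OF F] \<open>S \<noteq> U - S\<close> unfolding splits_def by simp
  finally have "(norm (vec y S))\<^sup>2 \<le> (C * norm (vec y U))\<^sup>2"
    unfolding U by (simp add: power_mult_distrib)
  then show ?thesis using C by (auto intro: power2_le_imp_le[OF _ mult_nonneg_nonneg])
qed

text \<open>The norm is convex in each multiplier, so the multipliers with values 0 and 1 are extreme.\<close>

lemma norm_vec_multiplier_unit:
  assumes "finite U" "U \<subseteq> {2..}" "finite T"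
    and "\<And>j. j \<in> U \<Longrightarrow> 0 \<le> l j \<and> l j \<le> 1" "\<And>j. j \<in> U - T \<Longrightarrow> l j \<in> {0, 1}"
  shows "norm (vec (\<lambda>j. l j * y j) U) \<le> C * norm (vec y U)"
  using assms(3-5)
proof (induction T arbitrary: l rule: finite_induct)
  case empty
  \<comment> \<open>\<open>T\<close> holds the coordinates where the multiplier may be fractional.
    Once it is empty, multiplying amounts to restricting to a subset.\<close>
  let ?S = "{j \<in> U. l j = 1}"
  have "vec (\<lambda>j. l j * y j) U = vec (\<lambda>j. l j * y j) ?S"
    unfolding vec_def by (rule sum.mono_neutral_right) (use \<open>finite U\<close> empty in auto)
  also have "\<dots> = vec y ?S" by (simp add: vec_def)
  finally show ?case using norm_vec_subset[of ?S U y] assms(1,2) by auto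
next
  case (insert t T)
  show ?case
  proof (cases "t \<in> U")
    case False
    with insert show ?thesis by (intro insert.IH) auto
  next
    case True
    define g where "g = (\<lambda>s. vec (\<lambda>j. (l(t := s)) j * y j) U)"
    have g: "norm (g s) \<le> C * norm (vec y U)" if "s \<in> {0, 1}" for s
      unfolding g_def using insert.prems that by (intro insert.IH) auto
    \<comment> \<open>A convex combination of the vectors in which the multiplier at
      \<open>t\<close> is replaced by 0 and by 1.\<close>
    have "vec (\<lambda>j. l j * y j) U = (1 - l t) *\<^sub>R g 0 + l t *\<^sub>R g 1"
      unfolding g_def vec_def scaleR_right.sum sum.distrib[symmetric]
      by (intro sum.cong) (auto simp: algebra_simps)
    also have "norm \<dots> \<le> (1 - l t) * norm (g 0) + l t * norm (g 1)"
      using insert.prems(1)[OF True] by (intro norm_triangle_le) auto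
    also have "\<dots> \<le> (1 - l t) * (C * norm (vec y U)) + l t * (C * norm (vec y U))"
      using insert.prems(1)[OF True] g by (intro add_mono mult_left_mono) auto
    finally show ?thesis by (simp add: algebra_simps)
  qed
qed

text \<open>The positive and negative parts of \<open>l / s\<close> have values between 0 and 1; the
  factor 2 comes from treating them separately.\<close>

lemma norm_vec_multiplier:
  assumes U: "finite U" "U \<subseteq> {2..}" and l: "\<And>j. j \<in> U \<Longrightarrow> \<bar>l j\<bar> \<le> s"
  shows "norm (vec (\<lambda>j. l j * y j) U) \<le> 2 * C * s * norm (vec y U)"
proof (cases "s > 0")
  case False
  then have "l j = 0" if "j \<in> U" for j using l[OF that] by simp
  then have "vec (\<lambda>j. l j * y j) U = 0" by (simp add: vec_def)
  moreover have "s = 0 \<or> U = {}" using l False by force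
  ultimately show ?thesis by (auto simp: vec_def)
next
  case True
  have "vec (\<lambda>j. l j * y j) U = s *\<^sub>R (vec (\<lambda>j. max 0 (l j / s) * y j) U
      - vec (\<lambda>j. max 0 (- l j / s) * y j) U)"
    unfolding vec_def sum_subtractf[symmetric] scaleR_right.sum
    using True by (intro sum.cong) (auto simp: max_def algebra_simps divide_simps)
  also have "norm \<dots> \<le> s * (C * norm (vec y U) + C * norm (vec y U))"
  proof -
    have "norm (vec (\<lambda>j. max 0 (l j / s) * y j) U) \<le> C * norm (vec y U)"
      using True l by (intro norm_vec_multiplier_unit[OF U U(1)]) (force simp: divide_simps)+
    moreover have "norm (vec (\<lambda>j. max 0 (- l j / s) * y j) U) \<le> C * norm (vec y U)"
      using True l by (intro norm_vec_multiplier_unit[OF U U(1)]) (force simp: divide_simps)+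
    ultimately show ?thesis using True norm_triangle_ineq4
      by (smt (verit) mult_left_mono norm_scaleR)
  qed
  finally show ?thesis by (simp add: algebra_simps)
qed

end

section \<open>Coordinates\<close>

locale asymptotic_ell2_basis = asymptotic_ell2 +
  assumes basis: "schauder_basis e" and normalized: "normalized e"
begin

definition coord :: "'a \<Rightarrow> nat \<Rightarrow> real" where
  "coord x = (THE a. a 0 = 0 \<and> (\<lambda>n. a (Suc n) *\<^sub>R e (Suc n)) sums x)"

lemma coord_0: "coord x 0 = 0"
  and coord_sums: "(\<lambda>n. coord x (Suc n) *\<^sub>R e (Suc n)) sums x"
  and coord_unique: "a 0 = 0 \<Longrightarrow> (\<lambda>n. a (Suc n) *\<^sub>R e (Suc n)) sums x \<Longrightarrow> coord x = a"
proof -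
  have ex1: "\<exists>!a. a 0 = 0 \<and> (\<lambda>n. a (Suc n) *\<^sub>R e (Suc n)) sums x"
    using basis by (simp add: schauder_basis_def)
  from theI'[OF ex1] show "coord x 0 = 0" "(\<lambda>n. coord x (Suc n) *\<^sub>R e (Suc n)) sums x"
    by (auto simp: coord_def)
  show "coord x = a" if "a 0 = 0" "(\<lambda>n. a (Suc n) *\<^sub>R e (Suc n)) sums x"
    unfolding coord_def by (rule the1_equality[OF ex1]) (use that in auto)
qed

lemma coord_add: "coord (x + y) = (\<lambda>j. coord x j + coord y j)"
  using sums_add[OF coord_sums[of x] coord_sums[of y]]
  by (intro coord_unique) (auto simp: coord_0 scaleR_add_left)

lemma coord_scaleR: "coord (c *\<^sub>R x) = (\<lambda>j. c * coord x j)"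
  using sums_scaleR_right[OF coord_sums[of x], of c] by (intro coord_unique) (auto simp: coord_0)

lemma linear_coord: "linear (\<lambda>x. coord x j)"
  by (rule linearI) (simp_all add: coord_add coord_scaleR)

lemma vec_add: "vec (\<lambda>j. a j + b j) S = vec a S + vec b S"
  by (simp add: vec_def scaleR_add_left sum.distrib)

lemma vec_scale: "vec (\<lambda>j. c * a j) S = c *\<^sub>R vec a S"
  by (simp add: vec_def scaleR_right.sum)

lemma vec_sum: "vec (\<lambda>j. \<Sum>i\<in>I. a i j) S = (\<Sum>i\<in>I. vec (a i) S)"
  unfolding vec_def scaleR_sum_left by (rule sum.swap)

lemma linear_vec_coord: "linear (\<lambda>x. vec (coord x) S)"
  by (rule linearI) (simp_all add: coord_add coord_scaleR vec_add vec_scale)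

lemma sums_iff_vec: "(\<lambda>n. a (Suc n) *\<^sub>R e (Suc n)) sums x \<longleftrightarrow> (\<lambda>N. vec a {1..N}) \<longlonglongrightarrow> x"
  by (simp add: sums_def vec_def sum.atLeast1_atMost_eq)

lemmas vec_coord_tendsto = coord_sums[unfolded sums_iff_vec]

lemma vec_drop_zeros: "finite T \<Longrightarrow> S \<subseteq> T \<Longrightarrow> (\<And>j. j \<in> T - S \<Longrightarrow> a j = 0) \<Longrightarrow> vec a T = vec a S"
  unfolding vec_def by (rule sum.mono_neutral_right) auto

lemma coord_basis_1: "coord (e 1) = (\<lambda>j. if j = 1 then 1 else 0)"
proof -
  have "(\<lambda>n. (if Suc n = 1 then 1 else 0) *\<^sub>R e (Suc n)) sums e 1"
    using sums_single[of 0 "\<lambda>n. e (Suc n)"] by (simp add: if_distrib if_distribR cong: if_cong)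
  then show ?thesis by (intro coord_unique) auto
qed

text \<open>With vanishing first coordinate all partial sums live beyond 1, where
  \<open>norm_vec_subset\<close> applies; then the partial sums tend to \<open>x\<close>.\<close>

lemma norm_vec_coord_of_zero:
  assumes zero: "coord x 1 = 0" and S: "finite S" "S \<subseteq> {2..}"
  shows "norm (vec (coord x) S) \<le> C * norm x"
proof (rule LIMSEQ_le_const)
  show "(\<lambda>N. C * norm (vec (coord x) {1..N})) \<longlonglongrightarrow> C * norm x"
    by (intro tendsto_mult tendsto_const tendsto_norm vec_coord_tendsto)
  obtain M where M: "S \<subseteq> {..M}" using S(1) finite_nat_set_iff_bounded_le by (metis atMost_iff subsetI)
  show "\<exists>M. \<forall>N\<ge>M. norm (vec (coord x) S) \<le> C * norm (vec (coord x) {1..N})"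
  proof (intro exI allI impI)
    fix N assume "M \<le> N"
    have "vec (coord x) {1..N} = vec (coord x) {2..N}"
    proof (rule vec_drop_zeros)
      fix j assume "j \<in> {1..N} - {2..N}"
      then have "j = 1" by auto
      with zero show "coord x j = 0" by simp
    qed auto
    moreover have "S \<subseteq> {2..N}" using M S(2) \<open>M \<le> N\<close> by force
    ultimately show "norm (vec (coord x) S) \<le> C * norm (vec (coord x) {1..N})"
      using norm_vec_subset[of S "{2..N}"] by simp
  qed
qed

text \<open>If the first coordinate functional were unbounded, \<open>e\<^sub>1\<close> would be a limit of vectors with
  vanishing first coordinate, whose expansions converge to a second expansion of \<open>e\<^sub>1\<close>.\<close>

lemma bounded_first_coord: "\<exists>K\<ge>0. \<forall>x. \<bar>coord x 1\<bar> \<le> K * norm x"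
proof (rule ccontr)
  assume "\<not> ?thesis"
  then have "\<exists>x. real (Suc m) * norm x < \<bar>coord x 1\<bar>" for m
    by (metis linorder_not_le of_nat_0_le_iff)
  then obtain x where x: "\<And>m. real (Suc m) * norm (x m) < \<bar>coord (x m) 1\<bar>" by metis
  have x1: "coord (x m) 1 \<noteq> 0" for m
    using x[of m] by (smt (verit) mult_nonneg_nonneg norm_ge_zero of_nat_0_le_iff)
  \<comment> \<open>\<open>x m\<close> is rescaled to first coordinate 1, which makes it short;
    subtracting it from \<open>e 1\<close> removes the first coordinate.\<close>
  define y where "y = (\<lambda>m. e 1 - (1 / coord (x m) 1) *\<^sub>R x m)"
  have coord_diff: "coord (u - v) = (\<lambda>j. coord u j - coord v j)" for u v
    using linear_diff[OF linear_coord] by auto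
  have y1: "coord (y m) 1 = 0" for m
    using x1[of m] by (simp add: y_def coord_diff coord_scaleR coord_basis_1[simplified])
  have y_close: "norm (e 1 - y m) < inverse (real (Suc m))" for m
  proof -
    have "norm (e 1 - y m) = norm (x m) / \<bar>coord (x m) 1\<bar>" by (simp add: y_def)
    also have "\<dots> < inverse (real (Suc m))"
      using x[of m] x1[of m] by (simp add: field_simps)
    finally show ?thesis .
  qed
  have "(\<lambda>m. e 1 - y m) \<longlonglongrightarrow> 0"
    by (rule tendsto_0_le[OF LIMSEQ_inverse_real_of_nat, of _ 1])
      (use y_close in \<open>auto intro!: always_eventually less_imp_le\<close>)
  then have "(\<lambda>m. e 1 - (e 1 - y m)) \<longlonglongrightarrow> e 1 - 0" by (intro tendsto_diff tendsto_const)
  then have y_lim: "y \<longlonglongrightarrow> e 1" by simp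
  have vec_diff: "vec (coord (u - v)) S = vec (coord u) S - vec (coord v) S" for u v S
    using linear_diff[OF linear_vec_coord] by auto
  \<comment> \<open>Differences of the \<open>y m\<close> have first coordinate 0, so this estimate
    is uniform in \<open>S\<close>.\<close>
  have close: "norm (vec (coord (y m)) S - vec (coord (y l)) S) \<le> C * norm (y m - y l)"
    if "finite S" "S \<subseteq> {2..}" for m l S
    unfolding vec_diff[symmetric] using that y1
    by (intro norm_vec_coord_of_zero) (simp_all add: coord_diff del: One_nat_def)
  have "\<exists>b. (\<lambda>m. coord (y m) j) \<longlonglongrightarrow> b" if j: "j \<ge> 2" for j
  proof -
    have dist: "\<bar>coord (y m) j - coord (y l) j\<bar> \<le> C * norm (y m - y l)" for m l
      using close[of "{j}" m l] j normalized
      by (simp add: vec_def normalized_def scaleR_diff_left[symmetric])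
    have "Cauchy (\<lambda>m. coord (y m) j)"
    proof (rule metric_CauchyI)
      fix r :: real assume "r > 0"
      then have "r / C > 0" using C by simp
      with LIMSEQ_imp_Cauchy[OF y_lim] obtain M where
        M: "\<And>m l. m \<ge> M \<Longrightarrow> l \<ge> M \<Longrightarrow> dist (y m) (y l) < r / C"
        unfolding Cauchy_def by blast
      have "dist (coord (y m) j) (coord (y l) j) < r" if "m \<ge> M" "l \<ge> M" for m l
        using M[OF that] dist[of m l] C
        by (auto simp: dist_norm field_simps intro: le_less_trans)
      then show "\<exists>M. \<forall>m\<ge>M. \<forall>l\<ge>M. dist (coord (y m) j) (coord (y l) j) < r" by blast
    qed
    then show ?thesis by (simp add: Cauchy_convergent_iff convergent_def)
  qed
  then obtain b' where b': "\<And>j. j \<ge> 2 \<Longrightarrow> (\<lambda>m. coord (y m) j) \<longlonglongrightarrow> b' j" by metis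
  \<comment> \<open>The coordinatewise limit. At 1 it is 0 because all \<open>y m\<close> vanish
    there, at 0 by the convention for coordinates.\<close>
  define b where "b = (\<lambda>j. if j \<ge> 2 then b' j else 0)"
  have b: "(\<lambda>m. coord (y m) j) \<longlonglongrightarrow> b j" if "j \<ge> 1" for j
  proof (cases "j = 1")
    case True
    then show ?thesis using y1 by (simp add: b_def)
  next
    case False
    then show ?thesis using b'[of j] that by (simp add: b_def)
  qed
  \<comment> \<open>Letting \<open>l\<close> tend to infinity keeps the estimate uniform in
    \<open>N\<close>, which permits the interchange of limits below.\<close>
  have vec_b: "norm (vec b {1..N} - vec (coord (y m)) {1..N}) \<le> C * norm (e 1 - y m)" for m N
  proof (rule tendsto_le)
    show "(\<lambda>l. C * norm (y l - y m)) \<longlonglongrightarrow> C * norm (e 1 - y m)"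
      by (intro tendsto_intros y_lim)
    show "(\<lambda>l. norm (vec (coord (y l)) {1..N} - vec (coord (y m)) {1..N}))
        \<longlonglongrightarrow> norm (vec b {1..N} - vec (coord (y m)) {1..N})"
      unfolding vec_def by (intro tendsto_intros b) auto
    have drop: "vec (coord (y l)) {1..N} = vec (coord (y l)) {2..N}" for l
    proof (rule vec_drop_zeros)
      fix j assume "j \<in> {1..N} - {2..N}"
      then have "j = 1" by auto
      with y1 show "coord (y l) j = 0" by simp
    qed auto
    show "\<forall>\<^sub>F l in sequentially. norm (vec (coord (y l)) {1..N} - vec (coord (y m)) {1..N})
        \<le> C * norm (y l - y m)"
      unfolding drop by (intro always_eventually allI close) auto
  qed simp
  have "(\<lambda>N. vec b {1..N}) \<longlonglongrightarrow> e 1"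
  proof (rule metric_LIMSEQ_I)
    fix r :: real assume "r > 0"
    then have "r / (4 * C) > 0" using C by simp
    \<comment> \<open>First \<open>m\<close> is fixed, then \<open>M\<close> is taken from the
      expansion of that one \<open>y m\<close>; the three errors are \<open>r / 4\<close>,
      \<open>r / 2\<close> and \<open>r / 4\<close>.\<close>
    then obtain m where "inverse (real (Suc m)) < r / (4 * C)" using reals_Archimedean by blast
    with y_close[of m] have "norm (e 1 - y m) < r / (4 * C)" by simp
    then have m: "C * norm (e 1 - y m) < r / 4" using C by (simp add: field_simps)
    moreover have "norm (e 1 - y m) \<le> C * norm (e 1 - y m)" using C by (simp add: mult_le_cancel_right1)
    ultimately have m': "norm (e 1 - y m) < r / 4" by simp
    have "r / 2 > 0" using \<open>r > 0\<close> by simp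
    from metric_LIMSEQ_D[OF vec_coord_tendsto[of "y m"] this] obtain M where
      M: "\<And>N. N \<ge> M \<Longrightarrow> dist (vec (coord (y m)) {1..N}) (y m) < r / 2" by blast
    show "\<exists>M. \<forall>N\<ge>M. dist (vec b {1..N}) (e 1) < r"
    proof (intro exI allI impI)
      fix N assume N: "N \<ge> M"
      have "dist (vec b {1..N}) (e 1) \<le> dist (vec b {1..N}) (vec (coord (y m)) {1..N})
          + dist (vec (coord (y m)) {1..N}) (y m) + dist (y m) (e 1)"
        using dist_triangle[of "vec b {1..N}" "e 1" "vec (coord (y m)) {1..N}"]
          dist_triangle[of "vec (coord (y m)) {1..N}" "e 1" "y m"] by linarith
      then show "dist (vec b {1..N}) (e 1) < r"
        using M[OF N] m m' vec_b[of N m] by (simp add: dist_norm norm_minus_commute)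
    qed
  qed
  then have "(\<lambda>n. b (Suc n) *\<^sub>R e (Suc n)) sums e 1" by (simp only: sums_iff_vec)
  then have "coord (e 1) = b" by (rule coord_unique[rotated]) (simp add: b_def)
  then have "coord (e 1) 1 = 0" by (simp add: b_def)
  then show False using coord_basis_1 by simp
qed

text \<open>Removing the first coordinate changes the norm by a bounded factor and does not affect
  the restriction to \<open>S\<close>. The restriction maps are therefore uniformly bounded on the
  whole space.\<close>

lemma norm_vec_coord: "\<exists>K\<ge>1. \<forall>x S. finite S \<longrightarrow> S \<subseteq> {2..} \<longrightarrow> norm (vec (coord x) S) \<le> K * norm x"
proof -
  obtain K where K: "K \<ge> 0" "\<And>x. \<bar>coord x 1\<bar> \<le> K * norm x" using bounded_first_coord by blast
  have "norm (vec (coord x) S) \<le> C * (1 + K) * norm x" if S: "finite S" "S \<subseteq> {2..}" for x S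
  proof -
    define z where "z = x - coord x 1 *\<^sub>R e 1"
    have coord_z: "coord z j = coord x j - coord x 1 * coord (e 1) j" for j
      using linear_diff[OF linear_coord] by (simp add: z_def coord_scaleR)
    have "vec (coord x) S = vec (coord z) S"
      unfolding vec_def using S(2) by (intro sum.cong) (auto simp: coord_z coord_basis_1[simplified])
    also have "norm \<dots> \<le> C * norm z"
      by (rule norm_vec_coord_of_zero[OF _ S]) (simp add: coord_z coord_basis_1[simplified])
    also have "norm z \<le> norm x + \<bar>coord x 1\<bar>"
      unfolding z_def using norm_triangle_ineq4[of x "coord x 1 *\<^sub>R e 1"] normalized
      by (simp add: normalized_def)
    also have "\<dots> \<le> (1 + K) * norm x" using K(2)[of x] by (simp add: algebra_simps)
    finally show ?thesis using C by (simp add: mult.assoc)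
  qed
  moreover have "C * (1 + K) \<ge> 1" using C K(1) by (metis add_increasing2 mult_ge1_I order_refl)
  ultimately show ?thesis by blast
qed

end

section \<open>The Hilbertian form\<close>

lemma bilinear_sum_products:
  fixes t :: "'i \<Rightarrow> 'a::real_vector \<Rightarrow> real"
  assumes "\<And>i. i \<in> I \<Longrightarrow> linear (t i)"
  shows "bilinear (\<lambda>x y. \<Sum>i\<in>I. t i x * t i y)"
  unfolding bilinear_def using assms
  by (auto intro!: linearI
      simp: linear_add linear_cmul algebra_simps sum.distrib sum_distrib_left)

text \<open>Ratios \<open>a / u\<close> are rounded to multiples of \<open>1 / N\<close>. If
  \<open>u = 0\<close> then \<open>a = 0\<close>, and division by zero gives the harmless ratio
  0.\<close>

lemma floor_quotient_approx:
  fixes a u :: real and N :: nat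
  assumes "\<bar>a\<bar> \<le> u" "N > 0"
  shows "\<bar>a - of_int \<lfloor>real N * (a / u)\<rfloor> / real N * u\<bar> \<le> u / real N"
    and "\<lfloor>real N * (a / u)\<rfloor> \<in> {- int N..int N}"
proof -
  have u: "u \<ge> 0" using assms by simp
  define w where "w = real N * (a / u)"
  have "\<bar>a / u\<bar> \<le> 1" using assms by (cases "u = 0") (auto simp: divide_simps)
  then have "real N * \<bar>a / u\<bar> \<le> real N * 1" by (intro mult_left_mono) auto
  then have "\<bar>w\<bar> \<le> real N" by (simp add: w_def abs_mult)
  then have "- real N \<le> w" "w \<le> real N" by linarith+
  then show "\<lfloor>real N * (a / u)\<rfloor> \<in> {- int N..int N}"
    unfolding w_def[symmetric] by (simp add: le_floor_iff floor_le_iff)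
  show "\<bar>a - of_int \<lfloor>real N * (a / u)\<rfloor> / real N * u\<bar> \<le> u / real N"
  proof (cases "u = 0")
    case False
    have "\<bar>w - of_int \<lfloor>w\<rfloor>\<bar> \<le> 1" by linarith
    then have "u / real N * \<bar>w - of_int \<lfloor>w\<rfloor>\<bar> \<le> u / real N * 1"
      using u by (intro mult_left_mono) auto
    moreover have "u / real N * \<bar>w - of_int \<lfloor>w\<rfloor>\<bar> = \<bar>u / real N * (w - of_int \<lfloor>w\<rfloor>)\<bar>"
      using u by (simp add: abs_mult)
    moreover have "u / real N * w = a" using False assms(2) by (simp add: w_def)
    then have "u / real N * (w - of_int \<lfloor>w\<rfloor>) = a - of_int \<lfloor>w\<rfloor> / real N * u"
      by (simp add: right_diff_distrib)
    ultimately show ?thesis unfolding w_def[symmetric] by (metis mult.right_neutral)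
  qed (use assms in auto)
qed

context asymptotic_ell2_basis
begin

text \<open>A subspace spanned by few well-conditioned vectors consists, up to a small error, of
  functions that on each of few sets are proportional to \<open>u = \<Sum>\<^sub>i \<bar>x\<^sub>i\<bar>\<close>. Norming functionals
  for the restrictions of \<open>u\<close> then give the Hilbertian form.\<close>

lemma hilbertian_complemented_tail:
  assumes K0: "K0 \<ge> 1" "\<And>x S. finite S \<Longrightarrow> S \<subseteq> {2..} \<Longrightarrow> norm (vec (coord x) S) \<le> K0 * norm x"
    and K: "K = C * (C * C)"
    and n: "n \<ge> 2"
    and x: "\<And>i. i < n \<Longrightarrow> norm (x i) \<le> 1" "\<And>i j. i < n \<Longrightarrow> j \<le> n \<Longrightarrow> coord (x i) j = 0"
    and g: "g \<ge> 1" "\<And>a. (\<Sum>i<n. \<bar>a i\<bar>) \<le> g * norm (\<Sum>i<n. a i *\<^sub>R x i)"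
    and N: "real N \<ge> 64 * K\<^sup>2 * C\<^sup>2 * K0 * real n * g"
    and count: "(2 * N + 1) ^ n \<le> 2 ^ (2 ^ (n - 1) - 1)"
  obtains P where "projection_onto P (span (x ` {..<n}))" "onorm P \<le> 2 * K * (K * K0)"
    "bm_dist_ell2 (span (x ` {..<n})) \<le> 2 * K * (K * K0)"
proof -
  have K1: "K \<ge> 1" unfolding K using C by (intro mult_ge1_I) auto
  have Npos: "N > 0"
  proof -
    have "64 * K\<^sup>2 * C\<^sup>2 * K0 * real n * g > 0" using K1 C K0(1) g(1) n by simp
    with N show ?thesis by (metis less_le_trans of_nat_0_less_iff)
  qed
  \<comment> \<open>The accuracy \<open>1 / (4 * g)\<close> makes the truncation error of a
    combination \<open>z\<close> at most \<open>norm z / 4\<close>, since its coefficients sum to at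
    most \<open>g * norm z\<close> in absolute value.\<close>
  have "\<forall>i<n. \<forall>\<^sub>F M in sequentially. norm (x i - vec (coord (x i)) {1..M}) \<le> 1 / (4 * g)"
  proof (intro allI impI)
    fix i
    have "1 / (4 * g) > 0" using g(1) by simp
    from tendstoD[OF vec_coord_tendsto[of "x i"] this]
    show "\<forall>\<^sub>F M in sequentially. norm (x i - vec (coord (x i)) {1..M}) \<le> 1 / (4 * g)"
      by eventually_elim (simp add: dist_norm norm_minus_commute)
  qed
  then have "\<forall>\<^sub>F M in sequentially. \<forall>i\<in>{..<n}. norm (x i - vec (coord (x i)) {1..M}) \<le> 1 / (4 * g)"
    by (intro eventually_ball_finite) auto
  then obtain M where M: "\<And>i. i < n \<Longrightarrow> norm (x i - vec (coord (x i)) {1..M}) \<le> 1 / (4 * g)"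
    by (auto simp: eventually_sequentially)
  \<comment> \<open>Coordinates up to \<open>n\<close> vanish on the \<open>x i\<close>, so the
    truncations live on a finite set beyond \<open>n\<close>.\<close>
  define D where "D = {n<..M}"
  have D: "finite D" "D \<subseteq> {2..}" "D \<subseteq> {n..}" using n by (auto simp: D_def)
  have trunc: "norm (x i - vec (coord (x i)) D) \<le> 1 / (4 * g)" if "i < n" for i
  proof -
    have "vec (coord (x i)) {1..M} = vec (coord (x i)) D"
      by (rule vec_drop_zeros) (use x(2)[OF that] in \<open>auto simp: D_def\<close>)
    with M[OF that] show ?thesis by simp
  qed
  define u where "u = (\<lambda>j. \<Sum>i<n. \<bar>coord (x i) j\<bar>)"
  have u_ge: "\<bar>coord (x i) j\<bar> \<le> u j" if "i < n" for i j
    unfolding u_def using that by (intro member_le_sum) auto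
  \<comment> \<open>Points of \<open>D\<close> are classified by the rounded ratios of all
    \<open>x i\<close> to \<open>u\<close>. The keys are extensional functions with
    \<open>2 * N + 1\<close> possible values at each \<open>i < n\<close>, whence the count.\<close>
  define key where "key = (\<lambda>j. \<lambda>i\<in>{..<n}. \<lfloor>real N * (coord (x i) j / u j)\<rfloor>)"
  define cell where "cell = (\<lambda>c. {j \<in> D. key j = c})"
  define \<S> where "\<S> = cell ` key ` D"
  have finS: "finite \<S>" using D by (simp add: \<S>_def)
  have cellS: "finite S" "S \<subseteq> {2..}" if "S \<in> \<S>" for S
    using that D by (auto simp: \<S>_def cell_def)
  have beyond: "sets_beyond n \<S>"
    unfolding sets_beyond_def
  proof (intro conjI ballI)
    show "disjoint \<S>" by (auto simp: pairwise_def \<S>_def cell_def disjnt_def)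
    fix S assume "S \<in> \<S>"
    with D show "finite S" "S \<noteq> {}" "S \<subseteq> {n..}" by (auto simp: \<S>_def cell_def)
  qed (rule finS)
  have UnS: "\<Union>\<S> = D" by (auto simp: \<S>_def cell_def)
  have "card \<S> \<le> card (key ` D)" unfolding \<S>_def using D by (intro card_image_le) auto
  also have "\<dots> \<le> card ({..<n} \<rightarrow>\<^sub>E {- int N..int N})"
  proof (rule card_mono)
    show "key ` D \<subseteq> {..<n} \<rightarrow>\<^sub>E {- int N..int N}"
      unfolding key_def image_subset_iff restrict_PiE_iff
      using floor_quotient_approx(2)[OF u_ge Npos] by blast
  qed (auto intro: finite_PiE)
  also have "\<dots> = (2 * N + 1) ^ n" by (simp add: card_PiE nat_add_distrib nat_mult_distrib)
  also note count
  finally have "splits K \<S>" unfolding K by (rule splits_double_exponential[OF beyond n])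
  then have split1: "(\<Sum>S\<in>\<S>. (norm (vec y S))\<^sup>2) \<le> K\<^sup>2 * (norm (vec y D))\<^sup>2"
    and split2: "(norm (vec y D))\<^sup>2 \<le> K\<^sup>2 * (\<Sum>S\<in>\<S>. (norm (vec y S))\<^sup>2)" for y
    by (auto simp: splits_def UnS)
  have "\<exists>f. linear f \<and> (\<forall>x. \<bar>f x\<bar> \<le> norm x) \<and> f (vec u S) = norm (vec u S)" for S
    by (metis norming_functional)
  then obtain f where f: "\<And>S. linear (f S)" "\<And>S x. \<bar>f S x\<bar> \<le> norm x"
    "\<And>S. f S (vec u S) = norm (vec u S)" by metis
  define t where "t = (\<lambda>S x. f S (vec (coord x) S))"
  have t: "linear (t S)" for S
    unfolding t_def using linear_compose[OF linear_vec_coord f(1)] by (simp add: o_def)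
  define B where "B = (\<lambda>x y. \<Sum>S\<in>\<S>. t S x * t S y)"
  have B: "bilinear B" unfolding B_def by (rule bilinear_sum_products) (rule t)
  have Bxx: "B x x = (\<Sum>S\<in>\<S>. (t S x)\<^sup>2)" for x by (simp add: B_def power2_eq_square)
  have upper: "B x x \<le> (K * K0)\<^sup>2 * (norm x)\<^sup>2" for x
  proof -
    have "B x x \<le> (\<Sum>S\<in>\<S>. (norm (vec (coord x) S))\<^sup>2)"
      unfolding Bxx t_def
      by (intro sum_mono abs_le_square_iff[THEN iffD1]) (use f(2) in auto)
    also have "\<dots> \<le> K\<^sup>2 * (norm (vec (coord x) D))\<^sup>2" by (rule split1)
    also have "\<dots> \<le> K\<^sup>2 * (K0 * norm x)\<^sup>2"
      using K0(2)[OF D(1,2)] by (intro mult_left_mono power_mono) auto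
    finally show ?thesis by (simp add: power_mult_distrib mult_ac)
  qed
  have norm_u: "norm (vec u D) \<le> 2 * C * K0 * real n"
  proof -
    \<comment> \<open>Absolute values are sign multipliers, each costing a factor
      \<open>2 * C\<close>.\<close>
    have "vec u D = (\<Sum>i<n. vec (\<lambda>j. sgn (coord (x i) j) * coord (x i) j) D)"
      by (simp add: u_def vec_sum abs_sgn mult.commute)
    also have "norm \<dots> \<le> (\<Sum>i<n. 2 * C * K0)"
    proof (rule sum_norm_le)
      fix i assume i: "i \<in> {..<n}"
      have "norm (vec (\<lambda>j. sgn (coord (x i) j) * coord (x i) j) D) \<le> 2 * C * 1 * norm (vec (coord (x i)) D)"
        by (rule norm_vec_multiplier[OF D(1,2)]) (simp add: abs_sgn_eq)
      also have "\<dots> \<le> 2 * C * 1 * (K0 * norm (x i))"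
        using C K0(2)[OF D(1,2)] by (intro mult_left_mono) auto
      also have "\<dots> \<le> 2 * C * 1 * (K0 * 1)"
        using C K0(1) x(1) i by (intro mult_left_mono) auto
      finally show "norm (vec (\<lambda>j. sgn (coord (x i) j) * coord (x i) j) D) \<le> 2 * C * K0" by simp
    qed
    finally show ?thesis by (simp add: mult_ac)
  qed
  have lower: "(norm z)\<^sup>2 \<le> (2 * K)\<^sup>2 * B z z" if z: "z \<in> span (x ` {..<n})" for z
  proof -
    obtain a where a: "z = (\<Sum>i<n. a i *\<^sub>R x i)" using z unfolding span_image_lessThan by blast
    define s where "s = (\<Sum>i<n. \<bar>a i\<bar>)"
    have s: "0 \<le> s" "s \<le> g * norm z" using g(2)[of a] by (auto simp: s_def a sum_nonneg)
    have coord_z: "coord z j = (\<Sum>i<n. a i * coord (x i) j)" for j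
      unfolding a by (simp add: linear_sum[OF linear_coord] coord_scaleR)
    have "norm (z - vec (coord z) D) \<le> norm z / 4"
    proof -
      have "vec (coord z) D = (\<Sum>i<n. a i *\<^sub>R vec (coord (x i)) D)"
        unfolding a by (simp add: linear_sum[OF linear_vec_coord] coord_scaleR vec_scale)
      then have "z - vec (coord z) D = (\<Sum>i<n. a i *\<^sub>R (x i - vec (coord (x i)) D))"
        unfolding a by (simp add: scaleR_diff_right sum_subtractf)
      also have "norm \<dots> \<le> (\<Sum>i<n. \<bar>a i\<bar> * (1 / (4 * g)))"
        using trunc by (intro sum_norm_le) (auto intro: mult_left_mono simp del: times_divide_eq_right)
      also have "\<dots> = s / (4 * g)" by (simp add: s_def sum_divide_distrib)
      also have "\<dots> \<le> norm z / 4" using s g(1) by (simp add: field_simps)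
      finally show ?thesis .
    qed
    then have z_le: "3 / 4 * norm z \<le> norm (vec (coord z) D)"
      using norm_triangle_ineq[of "z - vec (coord z) D" "vec (coord z) D"] by simp
    \<comment> \<open>Relative error on a cell: \<open>s / N\<close> from rounding,
      \<open>2 * C\<close> from \<open>norm_vec_multiplier\<close>.\<close>
    define r where "r = 2 * C * (s / real N)"
    have r: "r \<ge> 0" using s C by (simp add: r_def)
    have cell_le: "(norm (vec (coord z) S))\<^sup>2 \<le> 2 * (t S z)\<^sup>2 + 8 * r\<^sup>2 * (norm (vec u S))\<^sup>2"
      if S: "S \<in> \<S>" for S
    proof -
      obtain c where c: "S = cell c" using S by (auto simp: \<S>_def)
      \<comment> \<open>The common approximate ratio of \<open>z\<close> to \<open>u\<close> on the
        cell, read off from its key.\<close>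
      define l where "l = (\<Sum>i<n. a i * (of_int (c i) / real N))"
      have diff: "\<bar>coord z j - l * u j\<bar> \<le> s / real N * u j" if j: "j \<in> S" for j
      proof -
        have "l * u j = (\<Sum>i<n. a i * (of_int (c i) / real N * u j))"
          unfolding l_def sum_distrib_right by (simp only: mult.assoc)
        then have "coord z j - l * u j = (\<Sum>i<n. a i * (coord (x i) j - of_int (c i) / real N * u j))"
          by (simp only: coord_z right_diff_distrib sum_subtractf)
        also have "\<bar>\<dots>\<bar> \<le> (\<Sum>i<n. \<bar>a i\<bar> * (u j / real N))"
        proof (rule order.trans[OF sum_abs sum_mono])
          fix i assume i: "i \<in> {..<n}"
          have "c i = \<lfloor>real N * (coord (x i) j / u j)\<rfloor>"
            using j i by (auto simp: c cell_def key_def)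
          with floor_quotient_approx(1)[OF u_ge Npos, of i j] i
          have "\<bar>coord (x i) j - of_int (c i) / real N * u j\<bar> \<le> u j / real N" by (metis lessThan_iff)
          then show "\<bar>a i * (coord (x i) j - of_int (c i) / real N * u j)\<bar> \<le> \<bar>a i\<bar> * (u j / real N)"
            unfolding abs_mult by (rule mult_left_mono) simp
        qed
        finally show ?thesis by (simp add: s_def sum_distrib_right sum_divide_distrib)
      qed
      \<comment> \<open>The error is written as a multiplier of \<open>u\<close>. Where
        \<open>u j = 0\<close>, \<open>diff\<close> shows that \<open>z\<close> vanishes as
        well.\<close>
      define m where "m = (\<lambda>j. (coord z j - l * u j) / u j)"
      have u0: "u j \<ge> 0" for j by (simp add: u_def sum_nonneg)
      have mu: "coord z j = m j * u j + l * u j" if "j \<in> S" for j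
        using diff[OF that] by (cases "u j = 0") (auto simp: m_def)
      have m_le: "\<bar>m j\<bar> \<le> s / real N" if "j \<in> S" for j
        using diff[OF that] u0[of j] s(1) by (cases "u j = 0") (auto simp: m_def abs_divide field_simps)
      have eq: "vec (coord z) S = vec (\<lambda>j. m j * u j) S + l *\<^sub>R vec u S"
        unfolding vec_scale[symmetric] vec_add[symmetric] unfolding vec_def
        by (intro sum.cong) (auto simp: mu)
      have rest: "norm (vec (\<lambda>j. m j * u j) S) \<le> r * norm (vec u S)"
        unfolding r_def by (rule norm_vec_multiplier[OF cellS[OF S] m_le])
      \<comment> \<open>Since \<open>f S\<close> norms \<open>u\<close> on the cell, its value at
        \<open>z\<close> recovers the main part \<open>l *\<^sub>R vec u S\<close> up to the
        error.\<close>
      have "\<bar>l\<bar> * norm (vec u S) = \<bar>f S (l *\<^sub>R vec u S)\<bar>"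
        using f(3)[of S] by (simp add: linear_cmul[OF f(1)] abs_mult)
      also have "f S (l *\<^sub>R vec u S) = t S z - f S (vec (\<lambda>j. m j * u j) S)"
        unfolding t_def eq by (simp add: linear_add[OF f(1)])
      also have "\<bar>\<dots>\<bar> \<le> \<bar>t S z\<bar> + r * norm (vec u S)"
        using f(2)[of S "vec (\<lambda>j. m j * u j) S"] rest by linarith
      finally have "\<bar>l\<bar> * norm (vec u S) \<le> \<bar>t S z\<bar> + r * norm (vec u S)" .
      moreover have "norm (vec (coord z) S) \<le> r * norm (vec u S) + \<bar>l\<bar> * norm (vec u S)"
        unfolding eq using rest by (intro norm_triangle_le) simp
      ultimately have "norm (vec (coord z) S) \<le> \<bar>t S z\<bar> + 2 * r * norm (vec u S)" by simp
      then have "(norm (vec (coord z) S))\<^sup>2 \<le> (\<bar>t S z\<bar> + 2 * r * norm (vec u S))\<^sup>2"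
        by (rule power_mono) simp
      also have "\<dots> \<le> 2 * (t S z)\<^sup>2 + 2 * (2 * r * norm (vec u S))\<^sup>2"
        using sum_squares_bound[of "\<bar>t S z\<bar>" "2 * r * norm (vec u S)"]
        by (simp add: power2_sum)
      finally show ?thesis by (simp add: power_mult_distrib)
    qed
    have "(norm (vec (coord z) D))\<^sup>2 \<le> K\<^sup>2 * (\<Sum>S\<in>\<S>. (norm (vec (coord z) S))\<^sup>2)" by (rule split2)
    also have "\<dots> \<le> K\<^sup>2 * (\<Sum>S\<in>\<S>. 2 * (t S z)\<^sup>2 + 8 * r\<^sup>2 * (norm (vec u S))\<^sup>2)"
      by (intro mult_left_mono sum_mono cell_le) auto
    also have "\<dots> = K\<^sup>2 * (2 * B z z + 8 * r\<^sup>2 * (\<Sum>S\<in>\<S>. (norm (vec u S))\<^sup>2))"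
      by (simp add: Bxx sum.distrib sum_distrib_left)
    also have "\<dots> \<le> K\<^sup>2 * (2 * B z z + 8 * r\<^sup>2 * (K\<^sup>2 * (norm (vec u D))\<^sup>2))"
      by (intro mult_left_mono add_left_mono split1) auto
    also have "\<dots> = 2 * K\<^sup>2 * B z z + 8 * (K\<^sup>2 * r * norm (vec u D))\<^sup>2"
      by (simp add: power_mult_distrib algebra_simps power2_eq_square)
    \<comment> \<open>The two multiplier constants give \<open>4 * C\<^sup>2\<close>, so the lower
      bound on \<open>N\<close>, with 64 = 4 * 16, brings the error down to
      \<open>norm z / 16\<close>.\<close>
    also have "\<dots> \<le> 2 * K\<^sup>2 * B z z + 8 * (norm z / 16)\<^sup>2"
    proof -
      have "K\<^sup>2 * r * norm (vec u D) \<le> K\<^sup>2 * r * (2 * C * K0 * real n)"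
        using norm_u r by (intro mult_left_mono) auto
      also have "\<dots> = 4 * K\<^sup>2 * C\<^sup>2 * K0 * real n / real N * s"
        by (simp add: r_def power2_eq_square)
      also have "\<dots> \<le> 4 * K\<^sup>2 * C\<^sup>2 * K0 * real n / real N * (g * norm z)"
        using s K0(1) by (intro mult_left_mono) auto
      also have "\<dots> = (64 * K\<^sup>2 * C\<^sup>2 * K0 * real n * g) / real N * (norm z / 16)" by simp
      also have "\<dots> \<le> 1 * (norm z / 16)"
        using N Npos by (intro mult_right_mono) (auto simp: divide_le_eq)
      finally have "K\<^sup>2 * r * norm (vec u D) \<le> norm z / 16" by simp
      then have "(K\<^sup>2 * r * norm (vec u D))\<^sup>2 \<le> (norm z / 16)\<^sup>2"
        using r by (intro power_mono) auto
      then show ?thesis by simp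
    qed
    finally have "(norm (vec (coord z) D))\<^sup>2 \<le> 2 * K\<^sup>2 * B z z + (norm z)\<^sup>2 / 32"
      by (simp add: power_divide)
    moreover have "(3 / 4 * norm z)\<^sup>2 \<le> (norm (vec (coord z) D))\<^sup>2"
      using z_le by (rule power_mono) simp
    ultimately have "9 / 16 * (norm z)\<^sup>2 \<le> 2 * K\<^sup>2 * B z z + (norm z)\<^sup>2 / 32"
      by (simp add: power_mult_distrib power_divide)
    \<comment> \<open>The error is absorbed on the left: 9/16 - 1/32 exceeds 1/2.\<close>
    then have "(norm z)\<^sup>2 \<le> 4 * (K\<^sup>2 * B z z)"
      using zero_le_power2[of "norm z"] by linarith
    then show ?thesis by (simp add: power_mult_distrib)
  qed
  show thesis
  proof (rule hilbertian_complemented[OF B _ _ upper, of "x ` {..<n}" "2 * K"])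
    show "B x y = B y x" for x y by (simp add: B_def mult.commute)
    show "0 \<le> B x x" for x by (simp add: Bxx sum_nonneg)
    show "0 \<le> K * K0" "0 \<le> 2 * K" using K1 K0(1) by auto
  qed (use lower that in auto)
qed

end

section \<open>Large and small dimensions, and the conclusion\<close>

text \<open>The logarithm of the left side is at most of order \<open>n\<^sup>2\<close>, while that
  of the right side grows like \<open>2 ^ n\<close>. The summand 1 leaves room for rounding
  \<open>N\<close> up.\<close>

lemma eventually_power_le_double_exponential:
  fixes A :: real
  assumes "A > 0"
  shows "\<forall>\<^sub>F n in sequentially. \<forall>N. real N \<le> A * real n * 5 ^ n + 1 \<longrightarrow>
    (2 * N + 1) ^ n \<le> 2 ^ (2 ^ (n - 1) - 1)"
proof -
  have "\<forall>\<^sub>F n in sequentially.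
      real n * ln (2 * (A * real n * 5 ^ n + 1) + 1) \<le> (2 ^ n / 2 - 1) * ln 2"
    using assms by real_asymp
  with eventually_ge_at_top[of 1] show ?thesis
  proof eventually_elim
    case (elim n)
    show ?case
    proof (intro allI impI)
      fix N assume N: "real N \<le> A * real n * 5 ^ n + 1"
      define X where "X = 2 * (A * real n * 5 ^ n + 1) + 1"
      have "X > 0" using N by (simp add: X_def)
      have pow: "2 ^ n / 2 - 1 = real (2 ^ (n - 1) - 1)"
        using elim(1) by (cases n) (auto simp: of_nat_diff)
      have "real ((2 * N + 1) ^ n) = real (2 * N + 1) ^ n" by simp
      also have "\<dots> \<le> X ^ n" using N by (intro power_mono) (auto simp: X_def)
      also have "\<dots> = exp (real n * ln X)" using \<open>X > 0\<close> by (simp add: exp_of_nat_mult)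
      also have "\<dots> \<le> exp (real (2 ^ (n - 1) - 1) * ln 2)"
        using elim(2) unfolding X_def[symmetric] pow by simp
      also have "\<dots> = 2 ^ (2 ^ (n - 1) - 1)" by (subst exp_of_nat_mult) simp
      finally show "(2 * N + 1) ^ n \<le> 2 ^ (2 ^ (n - 1) - 1)"
        by (metis of_nat_le_iff of_nat_numeral of_nat_power)
    qed
  qed
qed

text \<open>The form is the square of a functional norming \<open>u\<close>. The case
  \<open>u = 0\<close> is included and serves the zero subspace.\<close>

lemma hilbertian_complemented_line:
  fixes u :: "'a::real_normed_vector"
  obtains P where "projection_onto P (span {u})" "onorm P \<le> 1" "bm_dist_ell2 (span {u}) \<le> 1"
proof -
  obtain f where f: "linear f" "\<And>x. \<bar>f x\<bar> \<le> norm x" "f u = norm u"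
    using norming_functional[of u] by blast
  define B where "B = (\<lambda>x y. f x * f y)"
  have "bilinear B"
    using bilinear_sum_products[of "{()}" "\<lambda>_. f"] f(1) by (simp add: B_def)
  moreover have "B x x \<le> 1\<^sup>2 * (norm x)\<^sup>2" for x
    using power_mono[OF f(2)[of x], of 2] by (simp add: B_def power2_eq_square)
  moreover have "(norm x)\<^sup>2 \<le> 1\<^sup>2 * B x x" if "x \<in> span {u}" for x
  proof -
    obtain c where "x = c *\<^sub>R u" using \<open>x \<in> span {u}\<close> by (auto simp: span_singleton)
    then show ?thesis by (simp add: B_def linear_cmul[OF f(1)] f(3) power2_eq_square)
  qed
  ultimately show thesis
    using hilbertian_complemented[of B 1 "{u}" 1] that by (auto simp: B_def)
qed

lemma (in asymptotic_ell2_basis) weak_hilbert: "weak_hilbert_space TYPE('a)"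
proof -
  define K where "K = C * (C * C)"
  have K1: "K \<ge> 1" unfolding K_def using C by (intro mult_ge1_I) auto
  obtain K0 where K0: "K0 \<ge> 1"
    "\<And>x S. finite S \<Longrightarrow> S \<subseteq> {2..} \<Longrightarrow> norm (vec (coord x) S) \<le> K0 * norm x"
    using norm_vec_coord by blast
  define A where "A = 64 * K\<^sup>2 * C\<^sup>2 * K0"
  have "A > 0" using K1 C K0(1) by (simp add: A_def)
  from eventually_power_le_double_exponential[OF this] obtain m where m: "\<And>n N. n \<ge> m \<Longrightarrow>
      real N \<le> A * real n * 5 ^ n + 1 \<Longrightarrow> (2 * N + 1) ^ n \<le> 2 ^ (2 ^ (n - 1) - 1)"
    unfolding eventually_sequentially by blast
  define p where "p = max m 2"
  \<comment> \<open>If \<open>n < p\<close>, then \<open>dim E \<le> 2 * p\<close> and one dimension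
    suffices. Otherwise \<open>p \<ge> 2\<close> gives \<open>\<delta> \<le> 1 / 4\<close>, while
    \<open>dim E \<le> 4 * n\<close>.\<close>
  define \<delta> where "\<delta> = 1 / (2 * real p)"
  define L where "L = 2 * K * (K * K0)"
  have p: "p \<ge> m" "p \<ge> 2" by (auto simp: p_def)
  have L1: "L \<ge> 1"
  proof -
    have "1 \<le> K * (K * K0)" using K1 K0(1) by (intro mult_ge1_I) auto
    then show ?thesis by (simp add: L_def)
  qed
  have "\<exists>F P. subspace F \<and> F \<subseteq> E \<and> projection_onto P F \<and> \<delta> * real (dim E) \<le> real (dim F)
      \<and> bm_dist_ell2 F \<le> L \<and> onorm P \<le> L" if E: "fin_dim_subspace E" for E :: "'a set"
  proof -
    obtain B0 where B0: "finite B0" "E = span B0" using E by (auto simp: fin_dim_subspace_def)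
    then have subE: "subspace E" by simp
    obtain S where S: "S \<subseteq> E" "independent S" "E \<subseteq> span S" "card S = dim E"
      using basis_exists by blast
    have finS: "finite S" using independent_span_bound[OF B0(1) S(2)] S(1) B0(2) by simp
    have ES: "E = span S" using S subE by (simp add: span_minimal subset_antisym)
    define n where "n = dim E div 2"
    show ?thesis
    proof (cases "n \<ge> p")
      case False
      obtain u where u: "u \<in> E" "dim E = 0 \<or> u \<noteq> 0"
      proof (cases "dim E = 0")
        case True
        then show thesis using that[of 0] subspace_0[OF subE] by simp
      next
        case False
        then obtain u where "u \<in> S" using S(4) by fastforce
        then show thesis using that[of u] S(1,2) dependent_zero by blast
      qed
      obtain P where P: "projection_onto P (span {u})" "onorm P \<le> 1" "bm_dist_ell2 (span {u}) \<le> 1"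
        by (rule hilbertian_complemented_line)
      have "\<delta> * real (dim E) \<le> real (dim (span {u}))"
      proof (cases "dim E = 0")
        case dimE: False
        have "dim (span {u}) = 1" using u(2) dimE by (simp add: dim_span dim_eq_card_independent)
        moreover have "dim E \<le> 2 * p" using False by (simp add: n_def)
        then have "\<delta> * real (dim E) \<le> 1" using p(2) by (simp add: \<delta>_def divide_simps)
        ultimately show ?thesis by simp
      qed simp
      moreover have "span {u} \<subseteq> E" using u(1) subE by (simp add: span_minimal)
      ultimately show ?thesis using P L1 by (intro exI[of _ "span {u}"] exI[of _ P]) auto
    next
      case True
      \<comment> \<open>At least \<open>dim E - n \<ge> n\<close> independent vectors remain after
        \<open>n\<close> coordinates are annihilated.\<close>
      obtain T where T: "finite T" "independent T" "T \<subseteq> span S" "card S \<le> card T + n"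
        "\<And>i x. i < n \<Longrightarrow> x \<in> T \<Longrightarrow> coord x (Suc i) = 0"
        using independent_common_kernel[of "\<lambda>i x. coord x (Suc i)", OF linear_coord finS S(2), of n]
        by blast
      have "n \<le> card T" using T(4) S(4) by (simp add: n_def)
      from well_conditioned_vectors[OF T(1,2) this] obtain x :: "nat \<Rightarrow> 'a" where
        x: "\<And>i. i < n \<Longrightarrow> x i \<in> span T \<and> norm (x i) \<le> 1"
        and bound: "\<And>a. (\<Sum>i<n. \<bar>a i\<bar>) \<le> 5 ^ n * norm (\<Sum>i<n. a i *\<^sub>R x i)" by blast
      \<comment> \<open>The functionals with index below \<open>n\<close> are the coordinates 1 to
        \<open>n\<close>; coordinate 0 vanishes by convention.\<close>
      have zero: "coord (x i) j = 0" if "i < n" "j \<le> n" for i j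
      proof (cases j)
        case (Suc k)
        show ?thesis
          unfolding Suc
          by (rule linear_eq_0_on_span[OF linear_coord, of T]) (use T(5) x that Suc in auto)
      qed (simp add: coord_0)
      define N where "N = nat \<lceil>A * real n * 5 ^ n\<rceil>"
      have N: "A * real n * 5 ^ n \<le> real N" "real N \<le> A * real n * 5 ^ n + 1"
        using \<open>A > 0\<close> by (auto simp: N_def)
      obtain P where P: "projection_onto P (span (x ` {..<n}))" "onorm P \<le> L"
          "bm_dist_ell2 (span (x ` {..<n})) \<le> L"
        unfolding L_def
      proof (rule hilbertian_complemented_tail[OF K0 K_def])
        show "2 \<le> n" using True p by simp
        show "64 * K\<^sup>2 * C\<^sup>2 * K0 * real n * 5 ^ n \<le> real N" using N(1) by (simp add: A_def)
        show "(2 * N + 1) ^ n \<le> 2 ^ (2 ^ (n - 1) - 1)" using m[OF _ N(2)] True p by simp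
      qed (use x zero bound in auto)
      have "x ` {..<n} \<subseteq> span T" using x by auto
      moreover have "span T \<subseteq> E" using T(3) ES by (simp add: span_minimal)
      ultimately have "span (x ` {..<n}) \<subseteq> E" using subE by (meson order_trans span_minimal)
      moreover have "\<delta> * real (dim E) \<le> real (dim (span (x ` {..<n})))"
      proof -
        have "dim E \<le> 2 * n + 1" by (simp add: n_def)
        then have "real (dim E) \<le> 4 * real n" using True p(2) by simp
        then have "\<delta> * real (dim E) \<le> 1 / 4 * (4 * real n)"
          using p(2) by (intro mult_mono) (auto simp: \<delta>_def divide_simps)
        then show ?thesis unfolding dim_span_bounded_coefficients[OF bound] by simp
      qed
      ultimately show ?thesis using P by (intro exI[of _ "span (x ` {..<n})"] exI[of _ P]) auto
    qed
  qed
  moreover have "\<delta> > 0" using p(2) by (simp add: \<delta>_def)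
  ultimately show ?thesis unfolding weak_hilbert_space_def using L1 by blast
qed

theorem theorem3p1:
  fixes e :: "nat \<Rightarrow> 'a::banach"
  assumes "unconditional_basis e"
    and "normalized e"
    and "asymptotic_lp_disjoint 2 e"
  shows "weak_hilbert_space TYPE('a)"
proof -
  obtain C where C: "\<And>n x. (\<forall>i\<in>{1..n}. x i \<in> c00 \<and> norm (basis_vec e (x i)) = 1) \<and>
      S1_allowable n (\<lambda>i. supp (x i)) \<Longrightarrow> lp_equivalent C 2 n (\<lambda>i. basis_vec e (x i))"
    using assms(3) unfolding asymptotic_lp_disjoint_def by blast
  \<comment> \<open>Enlarging the constant only weakens the equivalence, so it may be taken at least
    1.\<close>
  interpret asymptotic_ell2_basis e "max C 1"
  proof
    show "lp_equivalent (max C 1) 2 n (\<lambda>i. basis_vec e (x i))"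
      if "\<forall>i\<in>{1..n}. x i \<in> c00 \<and> norm (basis_vec e (x i)) = 1" "S1_allowable n (\<lambda>i. supp (x i))"
      for n x
      using C that by (intro lp_equivalent_mono[OF C]) auto
  qed (use assms in \<open>auto simp: unconditional_basis_def\<close>)
  show ?thesis by (rule weak_hilbert)
qed

end
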